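(* Let $k$ be a field of characteristic zero and let $\mathcal A$ be a central hyperplane arrangement of rank $n$ in $k^n$, defined by linear forms $\ell_1,\ldots,\ell_m\in R:=k[x_1,\ldots,x_n]$. Put $f:=\ell_1\cdots\ell_m$, let $J_f:=(\partial f/\partial x_1,\ldots,\partial f/\partial x_n)\subseteq R$ be its gradient ideal, and let $I:=(f/\ell_1,\ldots,f/\ell_m)\subseteq R$ be the ideal of $(m-1)$-fold products. Then $J_f$ is a minimal reduction of $I$, and $\operatorname{red}_{J_f}(I)\leq n-1$.
   Context: A central hyperplane arrangement is a finite collection of distinct hyperplanes $H_i=V(\ell_i)$ through the origin, so the $\ell_i$ are nonzero linear forms that are pairwise non-proportional; its rank is $\dim_k\langle \ell_1,\ldots,\ell_m\rangle$, so rank $n$ means that the $\ell_i$ span $R_1$. For ideals $J\subseteq I$ of a Noetherian ring, $J$ is a reduction of $I$ if $I^{r+1}=JI^r$ for some $r\geq 0$; the least such $r$ is the reduction number $\operatorname{red}_J(I)$. A reduction of $I$ is minimal if it is minimal with respect to inclusion among the reductions of $I$. *)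

theory Defs
  imports
    "HOL-Library.Poly_Mapping"
    "HOL-Analysis.Finite_Cartesian_Product"
begin

section \<open>Polynomials in the variables $x_i$, $i \in {}$ \<open>'n\<close>\<close>

text \<open>A monomial is its exponent vector \<open>'n \<Rightarrow>\<^sub>0 nat\<close>; the ring structure is the one of
  \<^theory>\<open>HOL-Library.Poly_Mapping\<close>.  For a finite type \<open>'n\<close> this is the polynomial ring
  in \<open>CARD('n)\<close> variables.\<close>

type_synonym ('n, 'k) mpoly = "('n \<Rightarrow>\<^sub>0 nat) \<Rightarrow>\<^sub>0 'k"

definition mpoly_scale :: "'k::comm_ring_1 \<Rightarrow> ('n, 'k) mpoly \<Rightarrow> ('n, 'k) mpoly"
  where "mpoly_scale c p = Poly_Mapping.single 0 c * p"

definition mpoly_eval :: "'k::comm_ring_1 ^ 'n::finite \<Rightarrow> ('n, 'k) mpoly \<Rightarrow> 'k"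
  where "mpoly_eval v p =
    (\<Sum>a\<in>Poly_Mapping.keys p. Poly_Mapping.lookup p a * (\<Prod>i\<in>UNIV. (v $ i) ^ Poly_Mapping.lookup a i))"

definition partial_deriv :: "'n \<Rightarrow> ('n, 'k::comm_ring_1) mpoly \<Rightarrow> ('n, 'k) mpoly"
  where "partial_deriv i p =
    (\<Sum>a\<in>Poly_Mapping.keys p. Poly_Mapping.single (a - Poly_Mapping.single i 1)
       (of_nat (Poly_Mapping.lookup a i) * Poly_Mapping.lookup p a))"

text \<open>The graded piece $R_1$, including the zero form.\<close>

definition linear_forms :: "('n::finite, 'k::zero) mpoly set"
  where "linear_forms = {p. \<forall>a\<in>Poly_Mapping.keys p. (\<Sum>i\<in>UNIV. Poly_Mapping.lookup a i) = 1}"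

lemma vector_space_mpoly_scale:
  "vector_space (mpoly_scale :: 'k::field \<Rightarrow> ('n, 'k) mpoly \<Rightarrow> ('n, 'k) mpoly)"
  by unfold_locales
    (simp_all add: mpoly_scale_def algebra_simps single_add mult_single flip: mult.assoc)


section \<open>Ideals of a commutative ring and their reductions\<close>

text \<open>Ideals are the submodules of the ring acting on itself by multiplication.\<close>

lemma module_mult: "module ((*) :: 'a::comm_ring_1 \<Rightarrow> 'a \<Rightarrow> 'a)"
  by unfold_locales (simp_all add: algebra_simps)

definition is_ideal :: "'a::comm_ring_1 set \<Rightarrow> bool"
  where "is_ideal = module.subspace (*)"

definition ideal_gen :: "'a::comm_ring_1 set \<Rightarrow> 'a set"
  where "ideal_gen = module.span (*)"

definition ideal_mult :: "'a::comm_ring_1 set \<Rightarrow> 'a set \<Rightarrow> 'a set"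
  where "ideal_mult I J = ideal_gen {a * b | a b. a \<in> I \<and> b \<in> J}"

primrec ideal_power :: "'a::comm_ring_1 set \<Rightarrow> nat \<Rightarrow> 'a set"
  where
    "ideal_power I 0 = UNIV"
  | "ideal_power I (Suc r) = ideal_mult I (ideal_power I r)"

definition is_reduction :: "'a::comm_ring_1 set \<Rightarrow> 'a set \<Rightarrow> bool"
  where "is_reduction J I \<longleftrightarrow> is_ideal J \<and> is_ideal I \<and> J \<subseteq> I \<and>
    (\<exists>r. ideal_power I (r + 1) = ideal_mult J (ideal_power I r))"

text \<open>Meaningful only if \<open>J\<close> is a reduction of \<open>I\<close>; otherwise the least element is unspecified.\<close>

definition reduction_number :: "'a::comm_ring_1 set \<Rightarrow> 'a set \<Rightarrow> nat"
  where "reduction_number J I =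
    (LEAST r. ideal_power I (r + 1) = ideal_mult J (ideal_power I r))"

definition is_minimal_reduction :: "'a::comm_ring_1 set \<Rightarrow> 'a set \<Rightarrow> bool"
  where "is_minimal_reduction J I \<longleftrightarrow> is_reduction J I \<and>
    (\<forall>K. is_reduction K I \<and> K \<subseteq> J \<longrightarrow> K = J)"


section \<open>Hyperplane arrangements\<close>

definition zero_locus :: "('n::finite, 'k::comm_ring_1) mpoly \<Rightarrow> ('k ^ 'n) set"
  where "zero_locus p = {v. mpoly_eval v p = 0}"

text \<open>The forms \<open>l 1, \<dots>, l m\<close> define the arrangement; values of \<open>l\<close> outside \<open>{1..m}\<close> are irrelevant.\<close>

definition central_arrangement :: "nat \<Rightarrow> (nat \<Rightarrow> ('n::finite, 'k::field) mpoly) \<Rightarrow> bool"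
  where "central_arrangement m l \<longleftrightarrow>
    (\<forall>i\<in>{1..m}. l i \<in> linear_forms \<and> l i \<noteq> 0) \<and>
    (\<forall>i\<in>{1..m}. \<forall>j\<in>{1..m}. i \<noteq> j \<longrightarrow> zero_locus (l i) \<noteq> zero_locus (l j))"

definition arrangement_rank :: "nat \<Rightarrow> (nat \<Rightarrow> ('n::finite, 'k::field) mpoly) \<Rightarrow> nat"
  where "arrangement_rank m l = vector_space.dim mpoly_scale (l ` {1..m})"

definition defining_poly :: "nat \<Rightarrow> (nat \<Rightarrow> ('n::finite, 'k::field) mpoly) \<Rightarrow> ('n, 'k) mpoly"
  where "defining_poly m l = (\<Prod>i\<in>{1..m}. l i)"

definition gradient_ideal :: "('n::finite, 'k::field) mpoly \<Rightarrow> ('n, 'k) mpoly set"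
  where "gradient_ideal f = ideal_gen (range (\<lambda>i. partial_deriv i f))"

text \<open>The quotient \<open>f / l i\<close> is the product of the remaining forms.\<close>

definition fold_product_ideal :: "nat \<Rightarrow> (nat \<Rightarrow> ('n::finite, 'k::field) mpoly) \<Rightarrow> ('n, 'k) mpoly set"
  where "fold_product_ideal m l = ideal_gen ((\<lambda>i. \<Prod>j\<in>{1..m} - {i}. l j) ` {1..m})"

end

theory Submission
  imports Defs "HOL-Library.Multiset" "HOL-Computational_Algebra.Polynomial"
begin

text \<open>Put $y_i = 1/\ell_i$, so that $f/\ell_i = f y_i$, and for a linear functional $\varphi$ on forms put
  $\theta(\varphi) = \sum_i \varphi(\ell_i)\, f y_i$.  For $\varphi$ the coefficient of $x_j$ this is
  $\partial f/\partial x_j$, so $J_f$ is generated by the $\theta(\varphi)$.  Each flat $F$ of the arrangement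
  has its own version $\theta_F(\varphi)$, in which the sum is restricted to the forms in $F$.  Everything rests on
  Euler's identity on $F$: for a basis $B$ of $F$ with coordinates $\varphi_b$ one has
  $\sum_b b\,\theta_F(\varphi_b) = |F| f$, where $|F|$ is the number of forms in $F$.

  \<^emph>\<open>Reduction.\<close>  The power $I^d$ is generated by the monomials $f^d y^M$ for multisets $M$ of $d$ forms.
  Euler's identity, multiplied by $y^M$, writes $|F| f y^M$ as $\sum_b \theta_F(\varphi_b) y^{M - b}$ whenever
  $M$ spans $F$ and $B \subseteq M$, since $b y^M = y^{M-b}$; this is where characteristic zero enters.
  If $M - b$ still spans $F$ the term is good.  Otherwise $M - b$ spans a hyperplane $G$ of $F$ killed by
  $\varphi_b$, and if $|M|$ exceeds the rank of $F$, induction on the rank writes $y^{M-b}$ by multiples of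
  $\theta_G(\psi)$; the commutation in \<open>polar_product_lift\<close> turns $\theta_F(\varphi_b)\,\theta_G(\psi)$ into
  multiples of $\theta_F$ (lemma \<open>cofactors_in_polar_products\<close>).  As
  $\theta_F - \theta$ involves only forms outside $F$, the monomials of degree $n$ are then reduced modulo
  $J_f I^{n-1}$ to monomials of larger and larger rank, and for full rank Euler's identity for the whole
  arrangement finishes the proof.  Thus $I^n = J_f I^{n-1}$ (theorem \<open>cofactor_power_reduces\<close>).

  \<^emph>\<open>Minimality.\<close>  A reduction of $I$ strictly inside $J_f$ may be enlarged to an ideal $N$ that is
  maximal in $J_f$; then $\mathfrak n = (N : J_f)$ is a maximal ideal.  Let $B$ be a basis of the forms that lie
  in $\mathfrak n$, and $r = |B|$.  Near $\mathfrak n$ only these forms matter: $J_f$ is generated by the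
  $r$ elements $\theta(\varphi_b)$ modulo $\mathfrak n J_f$ (lemma \<open>polar_ideal_local_generators\<close>), so
  $N$ is generated by $r - 1$ elements modulo $\mathfrak n J_f$.  As $N$ is a reduction, the dimension of
  $I^d / \mathfrak n I^d$ over $R/\mathfrak n$ grows no faster than the number of monomials of degree $d$ in
  $r - 1$ variables (lemma \<open>cofactor_power_span_mod\<close>).  But the monomials of degree $d$
  in the $r$ elements $f/b$, $b \in B$, are linearly independent in it
  (lemma \<open>cofactors_independent_mod\<close>), a contradiction for large $d$.

  The independence is seen on an arc: a ring homomorphism $R \to R[s]$ sending $\ell$ to
  $\ell + \sum_b \varphi_b(\ell) s^{w_b}$.  Read modulo $\mathfrak n$, it gives every form, and so every
  monomial, an order of vanishing in $s$, and suitable weights $w_b$ make the orders of the monomials in the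
  $f/b$ distinct, while elements of $\mathfrak n$ have larger order than these orders differ by.

  Both arguments take place in the locale \<open>form_family\<close>, an algebra over a field of characteristic zero
  with a finite set of cancellable elements; the arc is a hypothesis of the theorem
  \<open>polar_ideal_minimal\<close>, supplied for the polynomial ring by \<open>deformation_exists\<close>.\<close>


section \<open>Calculus of ideals\<close>

lemmas ideal_gen_base = module.span_base[OF module_mult, folded ideal_gen_def]
  and ideal_gen_zero = module.span_zero[OF module_mult, folded ideal_gen_def]
  and ideal_gen_add = module.span_add[OF module_mult, folded ideal_gen_def]
  and ideal_gen_diff = module.span_diff[OF module_mult, folded ideal_gen_def]
  and ideal_gen_sum = module.span_sum[OF module_mult, folded ideal_gen_def]
  and ideal_gen_mult_left = module.span_scale[OF module_mult, folded ideal_gen_def]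
  and ideal_gen_mono = module.span_mono[OF module_mult, folded ideal_gen_def]
  and ideal_gen_minimal = module.span_minimal[OF module_mult, folded ideal_gen_def is_ideal_def]
  and ideal_gen_singleton = module.span_singleton[OF module_mult, folded ideal_gen_def]
  and ideal_gen_insert = module.span_breakdown_eq[OF module_mult, folded ideal_gen_def]
  and is_ideal_ideal_gen = module.subspace_span[OF module_mult, folded ideal_gen_def is_ideal_def]
  and ideal_gen_ideal = module.span_eq_iff[OF module_mult, folded ideal_gen_def is_ideal_def, THEN iffD2]
  and ideal_zero = module.subspace_0[OF module_mult, folded is_ideal_def]
  and ideal_add = module.subspace_add[OF module_mult, folded is_ideal_def]
  and ideal_diff = module.subspace_diff[OF module_mult, folded is_ideal_def]
  and ideal_sum = module.subspace_sum[OF module_mult, folded is_ideal_def]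
  and ideal_mult_left = module.subspace_scale[OF module_mult, folded is_ideal_def]

lemma ideal_gen_induct [consumes 1, case_names base step]:
  assumes "x \<in> ideal_gen S" and "P 0"
    and "\<And>c a y. a \<in> S \<Longrightarrow> P y \<Longrightarrow> P (c * a + y)"
  shows "P x"
  using module.span_induct_alt[OF module_mult, folded ideal_gen_def, of x S P] assms by blast

lemma ideal_gen_mult_set_minimal:
  assumes "\<And>a b. a \<in> A \<Longrightarrow> b \<in> B \<Longrightarrow> a * b \<in> I" and "is_ideal I"
    and "x \<in> ideal_gen A" and "y \<in> ideal_gen B"
  shows "x * y \<in> I"
proof -
  have ab: "a * y \<in> I" if "a \<in> A" for a
    using assms(4)
  proof (induction rule: ideal_gen_induct)
    case base
    show ?case using ideal_zero[OF assms(2)] by simp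
  next
    case (step c b z)
    have "a * (c * b + z) = c * (a * b) + a * z" by (simp add: algebra_simps)
    then show ?case
      using ideal_add[OF assms(2) ideal_mult_left[OF assms(2) assms(1)[OF that step(1)]] step(2)]
      by (simp only:)
  qed
  show ?thesis
    using assms(3)
  proof (induction rule: ideal_gen_induct)
    case base
    show ?case using ideal_zero[OF assms(2)] by simp
  next
    case (step c a z)
    have "(c * a + z) * y = c * (a * y) + z * y" by (simp add: algebra_simps)
    then show ?case
      using ideal_add[OF assms(2) ideal_mult_left[OF assms(2) ab[OF step(1)]] step(2)]
      by (simp only:)
  qed
qed

lemma ideal_mult_ideal_gen:
  "ideal_mult (ideal_gen A) (ideal_gen B) = ideal_gen {a * b |a b. a \<in> A \<and> b \<in> B}" (is "?L = ?R")
proof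
  have "a * b \<in> ?R" if "a \<in> A" "b \<in> B" for a b
    by (rule ideal_gen_base) (use that in blast)
  from ideal_gen_mult_set_minimal[OF this is_ideal_ideal_gen]
  show "?L \<subseteq> ?R"
    unfolding ideal_mult_def by (intro ideal_gen_minimal is_ideal_ideal_gen) blast
  show "?R \<subseteq> ?L"
    unfolding ideal_mult_def by (intro ideal_gen_mono) (auto intro: ideal_gen_base)
qed

lemma ideal_mult_mono: "A \<subseteq> A' \<Longrightarrow> B \<subseteq> B' \<Longrightarrow> ideal_mult A B \<subseteq> ideal_mult A' B'"
  unfolding ideal_mult_def by (intro ideal_gen_mono) blast

lemma ideal_mult_memI: "a \<in> A \<Longrightarrow> b \<in> B \<Longrightarrow> a * b \<in> ideal_mult A B"
  unfolding ideal_mult_def by (auto intro: ideal_gen_base)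

lemma is_ideal_ideal_mult: "is_ideal (ideal_mult A B)"
  unfolding ideal_mult_def by (rule is_ideal_ideal_gen)

lemma ideal_power_ideal_gen:
  fixes g :: "'b \<Rightarrow> 'a::comm_ring_1"
  shows "ideal_power (ideal_gen (g ` A)) d
   = ideal_gen {\<Prod>a\<in>#M. g a |M. M \<in> multisets_of_size A d}"
proof (induction d)
  case 0
  have "UNIV = ideal_gen {1 :: 'a}"
    by (auto simp: ideal_gen_singleton)
  then show ?case by simp
next
  case (Suc d)
  have "{a * b |a b. a \<in> g ` A \<and> b \<in> {\<Prod>a\<in>#M. g a |M. M \<in> multisets_of_size A d}}
        = {\<Prod>a\<in>#M. g a |M. M \<in> multisets_of_size A (Suc d)}" (is "?X = ?Y")
  proof
    show "?X \<subseteq> ?Y"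
    proof
      fix x assume "x \<in> ?X"
      then obtain a M where "a \<in> A" "M \<in> multisets_of_size A d" "x = (\<Prod>a\<in>#add_mset a M. g a)"
        by auto
      then show "x \<in> ?Y"
        by (intro CollectI exI[of _ "add_mset a M"]) (auto simp: multisets_of_size_def)
    qed
    show "?Y \<subseteq> ?X"
    proof
      fix x assume "x \<in> ?Y"
      then obtain M where M: "M \<in> multisets_of_size A (Suc d)" "x = (\<Prod>a\<in>#M. g a)" by auto
      then obtain a M' where "M = add_mset a M'"
        by (auto simp: multisets_of_size_def size_eq_Suc_imp_eq_union dest!: size_eq_Suc_imp_eq_union)
      then show "x \<in> ?X"
        using M by (fastforce simp: multisets_of_size_def)
    qed
  qed
  then show ?case using Suc by (simp add: ideal_mult_ideal_gen)
qed


section \<open>Cofactors of a family of forms\<close>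

text \<open>The forms are indexed by themselves, so \<open>L\<close> is a set; products are cancelled one form at a time.\<close>

locale form_family = vector_space scale
  for scale :: "'k::field_char_0 \<Rightarrow> 'a::comm_ring_1 \<Rightarrow> 'a" +
  fixes L :: "'a set"
  assumes finite_forms: "finite L"
    and scale_mult: "scale c x * y = scale c (x * y)"
    and form_cancel: "a \<in> L \<Longrightarrow> a * x = 0 \<Longrightarrow> x = 0"
begin

abbreviation functional :: "('a \<Rightarrow> 'k) \<Rightarrow> bool"
  where "functional \<equiv> Vector_Spaces.linear scale (*)"

text \<open>For \<open>a \<in> L\<close> this is $f/a$, where $f = \prod L$.\<close>

definition cofactor :: "'a \<Rightarrow> 'a"
  where "cofactor a = \<Prod>(L - {a})"

definition cofactors :: "'a multiset \<Rightarrow> 'a"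
  where "cofactors M = (\<Prod>a\<in>#M. cofactor a)"

text \<open>The element $\theta_F(\varphi)$; for linear forms and \<open>F = UNIV\<close> it is the derivative of
  $f = \prod L$ along $\varphi$.\<close>

definition polar :: "'a set \<Rightarrow> ('a \<Rightarrow> 'k) \<Rightarrow> 'a"
  where "polar F \<phi> = (\<Sum>a\<in>L \<inter> F. scale (\<phi> a) (cofactor a))"

text \<open>The basis is extended to the whole algebra so that coordinates are functionals defined everywhere,
  also on forms outside the span of \<open>B\<close>.\<close>

definition coord :: "'a set \<Rightarrow> 'a \<Rightarrow> 'a \<Rightarrow> 'k"
  where "coord B b v = representation (extend_basis B) v b"

lemma mult_scale: "x * scale c y = scale c (x * y)"
  by (metis mult.commute scale_mult)

lemma scale_eq_mult: "scale c x = scale c 1 * x"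
  by (simp add: scale_mult)

lemma ideal_scale_closed: "is_ideal I \<Longrightarrow> x \<in> I \<Longrightarrow> scale c x \<in> I"
  by (subst scale_eq_mult) (rule ideal_mult_left)

lemma cofactors_empty [simp]: "cofactors {#} = 1"
  and cofactors_add_mset [simp]: "cofactors (add_mset a M) = cofactor a * cofactors M"
  by (simp_all add: cofactors_def)

lemma mult_cofactor: "a \<in> L \<Longrightarrow> a * cofactor a = \<Prod>L"
  unfolding cofactor_def by (metis finite_forms prod.remove)

lemma defining_cancel: "\<Prod>L * x = 0 \<Longrightarrow> x = 0"
proof -
  have "\<Prod>S * x = 0 \<Longrightarrow> x = 0" if "S \<subseteq> L" for S
    using finite_subset[OF that finite_forms] that
  proof (induction S)
    case (insert a S)
    then have "a * (\<Prod>S * x) = 0" by (simp add: mult.assoc)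
    then show ?case using insert form_cancel by auto
  qed auto
  then show "\<Prod>L * x = 0 \<Longrightarrow> x = 0" by blast
qed

lemma functional_coord: "independent B \<Longrightarrow> functional (coord B b)"
  unfolding coord_def[abs_def]
  by (intro linear_representation independent_extend_basis span_extend_basis)

lemma coord_basis: "independent B \<Longrightarrow> b \<in> B \<Longrightarrow> b' \<in> B \<Longrightarrow> coord B b b' = (if b = b' then 1 else 0)"
  unfolding coord_def
  by (subst representation_basis) (use extend_basis_superset independent_extend_basis in auto)

lemma coord_sum:
  assumes "independent B" and "finite B" and "v \<in> span B"
  shows "(\<Sum>b\<in>B. scale (coord B b v) b) = v"
  unfolding coord_def
  using assms representation_extend[OF independent_extend_basis assms(3) extend_basis_superset]
  by (simp add: sum_representation_eq)

lemma coord_eq_0: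
  assumes "independent B" and "v \<in> span (B - {b})"
  shows "coord B b v = 0"
proof -
  have "coord B b v = representation (B - {b}) v b"
    unfolding coord_def
    using representation_extend[OF independent_extend_basis assms(2)] extend_basis_superset assms(1)
    by (metis Diff_subset subset_trans)
  also have "\<dots> = 0" using representation_ne_zero by blast
  finally show ?thesis .
qed

lemma coord_eq_0_iff:
  assumes "independent B" and "finite B" and "b \<in> B" and "v \<in> span B"
  shows "coord B b v = 0 \<longleftrightarrow> v \<in> span (B - {b})"
proof
  assume "coord B b v = 0"
  then have "v = (\<Sum>b'\<in>B - {b}. scale (coord B b' v) b')"
    using coord_sum[OF assms(1,2,4)] sum.remove[OF assms(2,3), of "\<lambda>b. scale (coord B b v) b"] by simp
  then show "v \<in> span (B - {b})"
    by (metis (no_types, lifting) span_base span_scale span_sum)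
qed (rule coord_eq_0[OF assms(1)])


section \<open>Euler's identity on a flat\<close>

lemma sum_basis_mult_polar:
  assumes "independent B" and "finite B"
  shows "(\<Sum>b\<in>B. b * polar F (coord B b))
         = (\<Sum>a\<in>L \<inter> F. cofactor a * (\<Sum>b\<in>B. scale (coord B b a) b))"
proof -
  have "(\<Sum>b\<in>B. b * polar F (coord B b)) = (\<Sum>b\<in>B. \<Sum>a\<in>L \<inter> F. cofactor a * scale (coord B b a) b)"
    by (simp add: polar_def sum_distrib_left mult_scale mult.commute)
  also have "\<dots> = (\<Sum>a\<in>L \<inter> F. cofactor a * (\<Sum>b\<in>B. scale (coord B b a) b))"
    by (subst sum.swap) (simp add: sum_distrib_left)
  finally show ?thesis .
qed

text \<open>A form in the span of \<open>B\<close> is the combination of \<open>B\<close> given by its coordinates, and a form times its cofactor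
  is always $f$; so after exchanging the sums each form of the flat contributes one $f$.\<close>

lemma euler_flat:
  assumes "independent B" and "finite B" and "L \<inter> F \<subseteq> span B"
  shows "(\<Sum>b\<in>B. b * polar F (coord B b)) = scale (of_nat (card (L \<inter> F))) (\<Prod>L)"
proof -
  have "(\<Sum>b\<in>B. b * polar F (coord B b)) = (\<Sum>a\<in>L \<inter> F. cofactor a * a)"
    unfolding sum_basis_mult_polar[OF assms(1,2)]
    by (intro sum.cong refl) (use assms in \<open>auto simp: coord_sum\<close>)
  also have "\<dots> = (\<Sum>a\<in>L \<inter> F. \<Prod>L)"
    by (intro sum.cong) (auto simp: mult_cofactor mult.commute)
  also have "\<dots> = scale (of_nat (card (L \<inter> F))) (\<Prod>L)"
    by (rule sum_constant_scale)
  finally show ?thesis .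
qed

lemma cofactors_remove:
  assumes "b \<in># M" and "b \<in> L"
  shows "b * cofactors M = \<Prod>L * cofactors (M - {#b#})"
  using assms
  by (metis cofactors_add_mset insert_DiffM mult.assoc mult_cofactor)

text \<open>Euler's identity times a monomial.  A form \<open>b\<close> of \<open>M\<close> cancels against one factor \<open>cofactor b\<close> and
  leaves $f$, which is then cancelled from both sides.\<close>

lemma cofactors_by_polars:
  assumes B: "independent B" "finite B" "B \<subseteq> set_mset M" "B \<subseteq> L"
    and F: "L \<inter> F \<subseteq> span B" and ne: "L \<inter> F \<noteq> {}"
  shows "cofactors M = scale (1 / of_nat (card (L \<inter> F)))
           (\<Sum>b\<in>B. polar F (coord B b) * cofactors (M - {#b#}))"
proof -
  let ?c = "of_nat (card (L \<inter> F)) :: 'k"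
  have c: "?c \<noteq> 0" using ne finite_forms by auto
  have "\<Prod>L * scale ?c (cofactors M) = (\<Sum>b\<in>B. b * polar F (coord B b)) * cofactors M"
    using euler_flat[OF B(1,2) F] by (simp add: scale_mult mult_scale)
  also have "\<dots> = (\<Sum>b\<in>B. polar F (coord B b) * (b * cofactors M))"
    by (simp add: sum_distrib_right sum_distrib_left ac_simps)
  also have "\<dots> = (\<Sum>b\<in>B. polar F (coord B b) * (\<Prod>L * cofactors (M - {#b#})))"
    using cofactors_remove B(3,4) by (intro sum.cong refl) (simp add: subset_iff)
  also have "\<dots> = \<Prod>L * (\<Sum>b\<in>B. polar F (coord B b) * cofactors (M - {#b#}))"
    by (simp add: sum_distrib_left ac_simps)
  finally have "\<Prod>L * (scale ?c (cofactors M) - (\<Sum>b\<in>B. polar F (coord B b) * cofactors (M - {#b#}))) = 0"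
    by (simp add: algebra_simps)
  from defining_cancel[OF this]
  have "(\<Sum>b\<in>B. polar F (coord B b) * cofactors (M - {#b#})) = scale ?c (cofactors M)"
    by simp
  then show ?thesis using c by simp
qed


section \<open>Straightening within a flat\<close>

text \<open>The multiples of $\theta_F$ by monomials of degree \<open>d\<close> that still span \<open>F\<close>.  Keeping the span fixed is
  essential: it is what allows straightening to take place inside one flat at a time.\<close>

definition polar_products :: "'a set \<Rightarrow> nat \<Rightarrow> 'a set"
  where "polar_products F d =
    {polar F \<phi> * cofactors M |\<phi> M. functional \<phi> \<and> M \<in> multisets_of_size L d \<and> span (set_mset M) = F}"

lemma card_le_dim:
  assumes "finite S" and "B \<subseteq> S" and "independent B"
  shows "card B \<le> dim S"
proof -
  obtain C where C: "B \<subseteq> C" "C \<subseteq> S" "independent C" "S \<subseteq> span C"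
    using maximal_independent_subset_extend[OF assms(2,3)] by blast
  have "card B \<le> card C" using C assms(1) finite_subset by (intro card_mono) blast+
  also have "card C = dim S" using C by (intro basis_card_eq_dim)
  finally show ?thesis .
qed

text \<open>The commutation step.  With \<open>G\<close> the span of \<open>M\<close>, a hyperplane of \<open>F\<close> on which \<open>\<phi>\<close> vanishes,
  $\theta_F(\varphi)\theta_G(\psi) = \theta_F(\psi)\theta_F(\varphi)
   - \theta_F(\varphi)(\theta_F(\psi) - \theta_G(\psi))$.
  Both $\theta_F(\varphi)$ and $\theta_F(\psi) - \theta_G(\psi)$ are combinations of cofactors of forms of
  \<open>F\<close> outside \<open>G\<close>, and the monomial \<open>M\<close> enlarged by any such form spans \<open>F\<close> again.\<close>

lemma polar_product_lift:
  assumes \<phi>: "functional \<phi>" and \<psi>: "functional \<psi>"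
    and M: "M \<in> multisets_of_size L d" and GF: "span (set_mset M) \<subseteq> F"
    and ker: "\<And>a. a \<in> span (set_mset M) \<Longrightarrow> \<phi> a = 0"
    and hyper: "\<And>a. a \<in> L \<inter> F - span (set_mset M) \<Longrightarrow> span (insert a (set_mset M)) = F"
  shows "polar F \<phi> * (polar (span (set_mset M)) \<psi> * cofactors M)
         \<in> ideal_gen (polar_products F (Suc d))"
proof -
  let ?G = "span (set_mset M)" and ?I = "ideal_gen (polar_products F (Suc d))"
  let ?D = "L \<inter> F - ?G"
  have prod: "polar F \<sigma> * cofactors (add_mset a M) \<in> ?I" if "functional \<sigma>" "a \<in> ?D" for \<sigma> a
  proof (rule ideal_gen_base)
    show "polar F \<sigma> * cofactors (add_mset a M) \<in> polar_products F (Suc d)"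
      unfolding polar_products_def using that hyper[of a] M
      by (intro CollectI exI[of _ \<sigma>] exI[of _ "add_mset a M"]) (auto simp: multisets_of_size_def)
  qed
  have comb: "polar F \<sigma> * ((\<Sum>a\<in>?D. scale (\<rho> a) (cofactor a)) * cofactors M) \<in> ?I"
    if "functional \<sigma>" for \<sigma> \<rho>
  proof -
    have "polar F \<sigma> * ((\<Sum>a\<in>?D. scale (\<rho> a) (cofactor a)) * cofactors M)
          = (\<Sum>a\<in>?D. scale (\<rho> a) (polar F \<sigma> * cofactors (add_mset a M)))"
      by (simp add: sum_distrib_left sum_distrib_right scale_mult mult_scale)
    also have "\<dots> \<in> ?I"
      by (intro ideal_gen_sum ideal_scale_closed is_ideal_ideal_gen prod that)
    finally show ?thesis .
  qed
  have split: "polar F \<sigma> = (\<Sum>a\<in>?D. scale (\<sigma> a) (cofactor a)) + polar ?G \<sigma>" for \<sigma>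
  proof -
    have "L \<inter> ?G = L \<inter> F - ?D" using GF by auto
    moreover have "?D \<subseteq> L \<inter> F" "finite (L \<inter> F)" using finite_forms by auto
    from sum.subset_diff[OF this]
    have "polar F \<sigma> = (\<Sum>a\<in>L \<inter> F - ?D. scale (\<sigma> a) (cofactor a)) + (\<Sum>a\<in>?D. scale (\<sigma> a) (cofactor a))"
      unfolding polar_def .
    ultimately show ?thesis by (simp add: polar_def)
  qed
  have "polar ?G \<phi> = 0"
    unfolding polar_def by (intro sum.neutral) (auto simp: ker)
  then have \<phi>D: "polar F \<phi> = (\<Sum>a\<in>?D. scale (\<phi> a) (cofactor a))"
    using split[of \<phi>] by simp
  have "polar F \<phi> * (polar ?G \<psi> * cofactors M)
        = polar F \<psi> * ((\<Sum>a\<in>?D. scale (\<phi> a) (cofactor a)) * cofactors M)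
        - polar F \<phi> * ((\<Sum>a\<in>?D. scale (\<psi> a) (cofactor a)) * cofactors M)"
    unfolding split[of \<psi>] by (subst (1 2) \<phi>D) (simp add: algebra_simps)
  also have "\<dots> \<in> ?I" by (intro ideal_gen_diff comb \<phi> \<psi>)
  finally show ?thesis .
qed

text \<open>Straightening: a monomial whose degree exceeds the rank of its span \<open>F\<close> is a combination of multiples of
  $\theta_F$.  The bound on the degree is inherited by \<open>M - {#b#}\<close> when that spans a hyperplane, because
  degree and rank both drop by one.\<close>

lemma cofactors_in_polar_products:
  assumes "independent B" and "B \<subseteq> set_mset M" and "set_mset M \<subseteq> L" and "set_mset M \<subseteq> span B"
    and "card B < size M"
  shows "cofactors M \<in> ideal_gen (polar_products (span B) (size M - 1))"
  using assms
proof (induction "card B" arbitrary: B M)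
  case 0
  have "finite B" using 0(3) finite_subset by blast
  then have "B = {}" using 0 by simp
  then have "set_mset M \<subseteq> {0}" using 0 by simp
  moreover obtain x where "x \<in># M" using 0 by fastforce
  ultimately have "0 \<in> L" using 0 by auto
  then have "x = 0" for x :: 'a using form_cancel[of 0 x] by simp
  then have "cofactors M = 0" by blast
  then show ?case by (simp add: ideal_gen_zero)
next
  case (Suc r)
  note B = Suc.prems
  let ?F = "span B" and ?I = "ideal_gen (polar_products (span B) (size M - 1))"
  have fB: "finite B" using B(2) finite_subset by blast
  have spanM: "span (set_mset M) = ?F"
    using B by (intro span_unique) (auto simp: span_mono span_minimal intro: span_base)
  have BL: "B \<subseteq> L" using B by auto
  obtain b0 where "b0 \<in> B" using Suc.hyps(2) by fastforce
  then have "L \<inter> ?F \<noteq> {}" using BL span_base by blast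
  note rec = cofactors_by_polars[OF B(1) fB B(2) BL _ this]
  have "polar ?F (coord B b) * cofactors (M - {#b#}) \<in> ?I" if b: "b \<in> B" for b
  proof -
    let ?N = "M - {#b#}"
    let ?G = "span (set_mset ?N)"
    have bM: "b \<in># M" using b B by auto
    have N: "?N \<in> multisets_of_size L (size M - 1)"
      using bM B(3) by (auto simp: multisets_of_size_def size_Diff_singleton dest: in_diffD)
    have NM: "set_mset ?N \<subseteq> set_mset M" by (auto dest: in_diffD)
    have GF: "?G \<subseteq> ?F" using spanM span_mono[OF NM] by simp
    have BN: "B - {b} \<subseteq> set_mset ?N" using B(2) set_mset_add_mset_insert[of b ?N] unfolding insert_DiffM[OF bM] by blast
    then have BG: "span (B - {b}) \<subseteq> ?G" by (rule span_mono)
    show ?thesis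
    proof (cases "?G = ?F")
      case True
      then show ?thesis
        using N functional_coord[OF B(1)]
        by (intro ideal_gen_base) (auto simp: polar_products_def)
    next
      case False
      \<comment> \<open>Otherwise the remaining forms span only the hyperplane on which the coordinate of \<open>b\<close> vanishes.\<close>
      have nb: "b \<notin> ?G"
      proof
        assume "b \<in> ?G"
        then have "B \<subseteq> ?G" using BN span_base by blast
        then have "?F \<subseteq> ?G" by (intro span_minimal) auto
        then show False using GF False by blast
      qed
      have ker: "coord B b a = 0" if a: "a \<in> ?G" for a
      proof (rule ccontr)
        assume "coord B b a \<noteq> 0"
        then have "a \<notin> span (B - {b})" using coord_eq_0[OF B(1)] by blast
        then have "b \<in> span (insert a (B - {b}))"
          using a GF b by (metis in_span_delete subsetD)
        also have "span (insert a (B - {b})) \<subseteq> ?G"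
          using a BG span_superset[of "B - {b}"] by (intro span_minimal) auto
        finally show False using nb by simp
      qed
      have Gsp: "?G = span (B - {b})"
        using BG ker coord_eq_0_iff[OF B(1) fB b] GF by blast
      have IH: "cofactors ?N \<in> ideal_gen (polar_products ?G (size ?N - 1))"
      proof -
        have "r = card (B - {b})" using Suc.hyps(2) b fB by simp
        moreover have "independent (B - {b})" using B(1) independent_mono by blast
        moreover have "set_mset ?N \<subseteq> span (B - {b})" using Gsp span_superset by blast
        moreover have "set_mset ?N \<subseteq> L" using NM B(3) by blast
        moreover have "card (B - {b}) < size ?N" using B(5) b fB bM Suc.hyps(2)
          by (simp add: size_Diff_singleton)
        ultimately show ?thesis using Suc.hyps(1)[of "B - {b}" ?N] BN Gsp by simp
      qed
      have hyper: "span (insert a (set_mset K)) = ?F" if "a \<in> L \<inter> ?F - ?G" "span (set_mset K) = ?G" for a K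
      proof -
        have "a \<notin> span (B - {b})" using that Gsp by blast
        then have "b \<in> span (insert a (B - {b}))" using that by (intro in_span_delete) auto
        also have "\<dots> \<subseteq> span (insert a (set_mset K))"
          using that Gsp span_superset[of "B - {b}"] span_mono[of "set_mset K" "insert a (set_mset K)"]
          by (intro span_minimal) (auto intro: span_base)
        finally have "b \<in> span (insert a (set_mset K))" .
        moreover have "B - {b} \<subseteq> span (insert a (set_mset K))"
          using that Gsp span_superset[of "B - {b}"] span_mono[of "set_mset K" "insert a (set_mset K)"] by auto
        ultimately have "B \<subseteq> span (insert a (set_mset K))" by auto
        moreover have "insert a (set_mset K) \<subseteq> ?F"
          using that GF span_superset[of "set_mset K"] by auto
        ultimately show ?thesis by (intro equalityI span_minimal subspace_span)
      qed
      have "size M \<ge> 2" using B(5) Suc.hyps(2) by simp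
      then have sz: "Suc (size ?N - 1) = size M - 1" using bM by (simp add: size_Diff_singleton)
      have "polar ?F (coord B b) * x \<in> ?I" if "x \<in> ideal_gen (polar_products ?G (size ?N - 1))" for x
        using that
      proof (induction rule: ideal_gen_induct)
        case (step c x y)
        from step(1) obtain \<psi> K where K: "functional \<psi>" "K \<in> multisets_of_size L (size ?N - 1)"
          "span (set_mset K) = ?G" "x = polar ?G \<psi> * cofactors K"
          by (auto simp: polar_products_def)
        have x: "polar ?F (coord B b) * x \<in> ?I"
          using polar_product_lift[OF functional_coord[OF B(1)] K(1,2), of ?F b] hyper[OF _ K(3)] ker GF sz
          by (simp add: K(3,4))
        have "c * (polar ?F (coord B b) * x) + polar ?F (coord B b) * y \<in> ?I"
          by (rule ideal_gen_add[OF ideal_gen_mult_left[OF x] step(2)])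
        then show ?case by (simp add: algebra_simps)
      qed (simp add: ideal_gen_zero)
      then show ?thesis using IH by blast
    qed
  qed
  then show ?case
    by (subst rec) (auto intro!: ideal_scale_closed is_ideal_ideal_gen ideal_gen_sum)
qed

section \<open>Reducing powers of the cofactor ideal\<close>

lemma polar_split:
  "polar UNIV \<sigma> = polar F \<sigma> + (\<Sum>a\<in>L - F. scale (\<sigma> a) (cofactor a))"
proof -
  have "L - (L - F) = L \<inter> F" by auto
  then show ?thesis
    unfolding polar_def using sum.subset_diff[of "L - F" L] finite_forms by simp
qed

definition polar_ideal :: "'a set"
  where "polar_ideal = ideal_gen {polar UNIV \<phi> |\<phi>. functional \<phi>}"

definition cofactor_ideal :: "'a set"
  where "cofactor_ideal = ideal_gen (cofactor ` L)"

lemma cofactor_ideal_power: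
  "ideal_power cofactor_ideal d = ideal_gen (cofactors ` multisets_of_size L d)"
  unfolding cofactor_ideal_def ideal_power_ideal_gen
  by (rule arg_cong[where f = ideal_gen]) (auto simp: cofactors_def)

lemma cofactors_in_power: "M \<in> multisets_of_size L d \<Longrightarrow> cofactors M \<in> ideal_power cofactor_ideal d"
  by (auto simp: cofactor_ideal_power intro: ideal_gen_base)

text \<open>Downward induction on the rank of the span \<open>F\<close> of a monomial of degree \<open>d\<close>.  Below full rank the degree
  exceeds the rank, so the monomial straightens to multiples of $\theta_F$; replacing $\theta_F$ by $\theta$
  costs only monomials with an additional form outside \<open>F\<close>, which have larger rank.\<close>

theorem cofactor_power_reduces:
  assumes "dim L \<le> d" and "d > 0"
  shows "ideal_power cofactor_ideal d \<subseteq> ideal_mult polar_ideal (ideal_power cofactor_ideal (d - 1))"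
proof -
  let ?I = "ideal_mult polar_ideal (ideal_power cofactor_ideal (d - 1))"
  have gen: "polar UNIV \<phi> * cofactors M \<in> ?I" if "functional \<phi>" "M \<in> multisets_of_size L (d - 1)" for \<phi> M
    using that by (auto intro!: ideal_mult_memI cofactors_in_power simp: polar_ideal_def intro: ideal_gen_base)
  have "cofactors M \<in> ?I" if "M \<in> multisets_of_size L d" for M
    using that
  proof (induction "dim L - dim (set_mset M)" arbitrary: M rule: less_induct)
    case less
    then have MsL: "set_mset M \<subseteq> L" and sz: "size M = d" by (auto simp: multisets_of_size_def)
    obtain B where B: "B \<subseteq> set_mset M" "independent B" "set_mset M \<subseteq> span B" "card B = dim (set_mset M)"
      using basis_exists by blast
    have fB: "finite B" using B(1) finite_subset by blast
    have BL: "B \<subseteq> L" using B MsL by blast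
    show ?case
    proof (cases "L \<subseteq> span B")
      case True
      obtain a where "a \<in># M" using sz assms(2) by (metis gr0_conv_Suc size_eq_Suc_imp_elem)
      then have "L \<inter> UNIV \<noteq> {}" using MsL by auto
      note eq = cofactors_by_polars[OF B(2) fB B(1) BL _ this]
      show ?thesis
      proof (subst eq)
        show "L \<inter> UNIV \<subseteq> span B" using True by auto
        show "scale (1 / of_nat (card (L \<inter> UNIV)))
            (\<Sum>b\<in>B. polar UNIV (coord B b) * cofactors (M - {#b#})) \<in> ?I"
        proof (intro ideal_scale_closed is_ideal_ideal_mult ideal_sum gen functional_coord B)
          fix b assume "b \<in> B"
          then show "M - {#b#} \<in> multisets_of_size L (d - 1)"
            using B(1) MsL sz by (auto simp: multisets_of_size_def size_Diff_singleton dest: in_diffD)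
        qed
      qed
    next
      case False
      then obtain t where t: "t \<in> L" "t \<notin> span B" by blast
      have "card (insert t B) \<le> dim L"
        using t BL B(2) by (intro card_le_dim finite_forms) (auto simp: independent_insertI)
      moreover have "t \<notin> B" using t span_base by blast
      ultimately have less_d: "card B < size M" and less_dim: "card B < dim L"
        using fB sz assms(1) by auto
      have "x \<in> ?I" if "x \<in> polar_products (span B) (d - 1)" for x
      proof -
        from that obtain \<phi> K where \<phi>: "functional \<phi>" and K: "K \<in> multisets_of_size L (d - 1)"
          "span (set_mset K) = span B" "x = polar (span B) \<phi> * cofactors K"
          by (auto simp: polar_products_def)
        have "cofactors (add_mset a K) \<in> ?I" if a: "a \<in> L - span B" for a
        proof (rule less.hyps)
          show 1: "add_mset a K \<in> multisets_of_size L d"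
            using K(1) a assms(2) by (auto simp: multisets_of_size_def)
          obtain C where C: "C \<subseteq> set_mset K" "independent C" "set_mset K \<subseteq> span C" "card C = dim (set_mset K)"
            using basis_exists by blast
          have "card C = card B"
            using C(4) K(2) B(2) by (metis dim_span_eq_card_independent dim_span)
          moreover have aC: "a \<notin> span C"
            using a K(2) span_mono[OF C(1)] by auto
          moreover have "card (insert a C) \<le> dim (set_mset (add_mset a K))"
            using aC C(1,2) by (intro card_le_dim) (auto simp: independent_insertI)
          moreover have "a \<notin> C" "finite C" using aC span_base C(1) finite_subset by blast+
          ultimately show "dim L - dim (set_mset (add_mset a K)) < dim L - dim (set_mset M)"
            using B(4) less_dim by simp
        qed
        then have "(\<Sum>a\<in>L - span B. scale (\<phi> a) (cofactors (add_mset a K))) \<in> ?I"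
          by (intro ideal_sum ideal_scale_closed is_ideal_ideal_mult)
        moreover have "x = polar UNIV \<phi> * cofactors K - (\<Sum>a\<in>L - span B. scale (\<phi> a) (cofactors (add_mset a K)))"
          unfolding K(3) polar_split[of \<phi> "span B"] by (simp add: algebra_simps sum_distrib_left mult_scale)
        ultimately show ?thesis
          using gen[OF \<phi> K(1)] ideal_diff[OF is_ideal_ideal_mult] by metis
      qed
      then have "ideal_gen (polar_products (span B) (d - 1)) \<subseteq> ?I"
        by (intro ideal_gen_minimal is_ideal_ideal_mult) blast
      then show ?thesis
        using cofactors_in_polar_products[OF B(2,1) MsL B(3) less_d] sz by auto
    qed
  qed
  then show ?thesis
    unfolding cofactor_ideal_power[of d] by (intro ideal_gen_minimal) (auto simp: is_ideal_ideal_mult)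
qed

end


section \<open>Maximal ideals and linear algebra over the residue field\<close>

text \<open>Maximality in the form in which it is used: every element outside \<open>n\<close> is a unit modulo \<open>n\<close>.\<close>

definition maximal_ideal :: "'a::comm_ring_1 set \<Rightarrow> bool"
  where "maximal_ideal n \<longleftrightarrow> is_ideal n \<and> 1 \<notin> n \<and> (\<forall>a. a \<notin> n \<longrightarrow> (\<exists>a'. a' * a - 1 \<in> n))"

lemma maximal_ideal_is_ideal: "maximal_ideal n \<Longrightarrow> is_ideal n"
  by (simp add: maximal_ideal_def)

lemma ideal_mult_right: "is_ideal I \<Longrightarrow> x \<in> I \<Longrightarrow> x * c \<in> I"
  by (metis ideal_mult_left mult.commute)

lemma ideal_uminus: "is_ideal I \<Longrightarrow> x \<in> I \<Longrightarrow> - x \<in> I"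
  using ideal_mult_left[of I x "-1"] by simp

lemma ideal_diff_mem_iff: "is_ideal I \<Longrightarrow> x - y \<in> I \<Longrightarrow> x \<in> I \<longleftrightarrow> y \<in> I"
  using ideal_add[of I "x - y" y] ideal_diff[of I x "x - y"] by auto

text \<open>An element outside \<open>n\<close> may be cancelled modulo any ideal \<open>P\<close> with $\mathfrak n x \subseteq P$, as if one had
  localised at \<open>n\<close>.\<close>

lemma maximal_ideal_unit_cancel:
  assumes "maximal_ideal n" and "s \<notin> n" and "s * x \<in> P" and "is_ideal P"
    and "\<And>a. a \<in> n \<Longrightarrow> a * x \<in> P"
  shows "x \<in> P"
proof -
  obtain s' where "s' * s - 1 \<in> n" using assms by (auto simp: maximal_ideal_def)
  from ideal_diff[OF assms(4) ideal_mult_left[OF assms(4,3), of s'] assms(5)[OF this]]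
  show ?thesis by (simp add: algebra_simps)
qed

lemma maximal_ideal_mult_iff:
  assumes "maximal_ideal n"
  shows "a * b \<in> n \<longleftrightarrow> a \<in> n \<or> b \<in> n"
  using maximal_ideal_unit_cancel[OF assms, of a b n] maximal_ideal_is_ideal[OF assms]
  by (meson ideal_mult_left ideal_mult_right)

lemma maximal_ideal_prod_iff:
  assumes "maximal_ideal n" and "finite S"
  shows "\<Prod>S \<in> n \<longleftrightarrow> (\<exists>a\<in>S. a \<in> n)"
  using assms(2)
  by (induction S) (use assms(1) in \<open>auto simp: maximal_ideal_mult_iff maximal_ideal_def\<close>)

text \<open>Since \<open>J\<close> is finitely generated, one first enlarges \<open>K\<close> by generators of \<open>J\<close> until a single further generator
  \<open>y\<close> would give all of \<open>J\<close>, and then takes an ideal that is maximal among those avoiding \<open>y\<close>.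
  The quotient $J/N$ is generated by \<open>y\<close> and is simple, so its annihilator is maximal.\<close>

lemma maximal_submodule:
  assumes K: "is_ideal K" "K \<subseteq> J" "K \<noteq> J" and J: "J = ideal_gen G" "finite G"
  obtains N y where "is_ideal N" and "K \<subseteq> N" and "N \<subseteq> J" and "y \<in> J" and "y \<notin> N"
    and "\<And>x. x \<in> J \<Longrightarrow> \<exists>c. x - c * y \<in> N"
    and "maximal_ideal {a. \<forall>x\<in>J. a * x \<in> N}"
proof -
  define \<S> where "\<S> = {S. S \<subseteq> G \<and> \<not> J \<subseteq> ideal_gen (K \<union> S)}"
  have "{} \<in> \<S>" using K by (auto simp: \<S>_def ideal_gen_ideal)
  moreover have "finite \<S>" using J(2) by (auto simp: \<S>_def intro: finite_subset[of _ "Pow G"])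
  ultimately obtain S where S: "S \<in> \<S>" and maxS: "\<And>S'. S' \<in> \<S> \<Longrightarrow> S \<subseteq> S' \<Longrightarrow> S' = S"
    using finite_has_maximal[of \<S>] by auto
  define K' where "K' = ideal_gen (K \<union> S)"
  have isJ: "is_ideal J" by (simp add: J is_ideal_ideal_gen)
  have GJ: "G \<subseteq> J" using ideal_gen_base J(1) by blast
  have "S \<subseteq> G" using S by (simp add: \<S>_def)
  then have "K' \<subseteq> J"
    unfolding K'_def using K(2) GJ by (intro ideal_gen_minimal isJ) blast
  then have K': "is_ideal K'" "K \<subseteq> K'" "K' \<subseteq> J"
    by (auto simp: K'_def is_ideal_ideal_gen intro: ideal_gen_base)
  have "\<not> G \<subseteq> K'" using S ideal_gen_minimal[OF _ K'(1), of G] by (auto simp: \<S>_def J(1) K'_def)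
  then obtain y where y: "y \<in> G" "y \<notin> K'" by blast
  have "insert y S \<notin> \<S>"
    using maxS[of "insert y S"] y ideal_gen_base[of y "K \<union> S"] by (auto simp: K'_def)
  then have "J \<subseteq> ideal_gen (K \<union> insert y S)" using S y by (auto simp: \<S>_def)
  also have "\<dots> \<subseteq> ideal_gen (insert y K')"
    by (rule ideal_gen_mono) (auto simp: K'_def intro: ideal_gen_base)
  finally have Jy: "\<exists>c. x - c * y \<in> K'" if "x \<in> J" for x
    using that K'(1) by (auto simp: ideal_gen_insert ideal_gen_ideal)
  define \<A> where "\<A> = {N. is_ideal N \<and> K' \<subseteq> N \<and> N \<subseteq> J \<and> y \<notin> N}"
  have "\<exists>N\<in>\<A>. \<forall>X\<in>\<A>. N \<subseteq> X \<longrightarrow> X = N"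
  proof (rule subset_Zorn_nonempty)
    show "\<A> \<noteq> {}" using K' y by (auto simp: \<A>_def)
    fix \<C> assume ne: "\<C> \<noteq> {}" and ch: "subset.chain \<A> \<C>"
    have CA: "\<And>X. X \<in> \<C> \<Longrightarrow> X \<in> \<A>" and lin: "\<And>X Y. X \<in> \<C> \<Longrightarrow> Y \<in> \<C> \<Longrightarrow> X \<subseteq> Y \<or> Y \<subseteq> X"
      using ch by (auto simp: subset_chain_def)
    have "is_ideal (\<Union>\<C>)"
      unfolding is_ideal_def module.subspace_def[OF module_mult]
    proof (intro conjI ballI allI)
      show "0 \<in> \<Union>\<C>" using ne CA ideal_zero by (auto simp: \<A>_def)
      show "c * x \<in> \<Union>\<C>" if "x \<in> \<Union>\<C>" for c x
        using that CA ideal_mult_left by (fastforce simp: \<A>_def)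
      show "x + z \<in> \<Union>\<C>" if xz: "x \<in> \<Union>\<C>" "z \<in> \<Union>\<C>" for x z
      proof -
        obtain X Z where "X \<in> \<C>" "Z \<in> \<C>" "x \<in> X" "z \<in> Z" using xz by blast
        then obtain Y where "Y \<in> \<C>" "x \<in> Y" "z \<in> Y" using lin by blast
        moreover then have "is_ideal Y" using CA by (auto simp: \<A>_def)
        ultimately show ?thesis using ideal_add by blast
      qed
    qed
    then show "\<Union>\<C> \<in> \<A>" using ne CA unfolding \<A>_def by blast
  qed
  then obtain N where N: "N \<in> \<A>" and maxN: "\<And>X. X \<in> \<A> \<Longrightarrow> N \<subseteq> X \<Longrightarrow> X = N" by blast
  have isN: "is_ideal N" "K' \<subseteq> N" "N \<subseteq> J" "y \<notin> N" using N by (auto simp: \<A>_def)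
  let ?n = "{a. \<forall>x\<in>J. a * x \<in> N}"
  have yJ: "y \<in> J" using y GJ by blast
  have in_n: "a \<in> ?n" if "a * y \<in> N" for a
  proof (intro CollectI ballI)
    fix x assume "x \<in> J"
    then obtain c where "x - c * y \<in> N" using Jy isN by blast
    then have xc: "x - c * y \<in> N" .
    have "a * (x - c * y) + c * (a * y) \<in> N"
      by (rule ideal_add[OF isN(1) ideal_mult_left ideal_mult_left]) (fact isN(1) xc that)+
    then show "a * x \<in> N" by (simp add: algebra_simps)
  qed
  have "maximal_ideal ?n"
    unfolding maximal_ideal_def
  proof (intro conjI allI impI)
    show "is_ideal ?n"
      unfolding is_ideal_def module.subspace_def[OF module_mult]
      by (auto simp: distrib_right mult.assoc intro: ideal_zero[OF isN(1)] ideal_add[OF isN(1)]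
          ideal_mult_left[OF isN(1)])
    show "1 \<notin> ?n" using yJ isN by auto
    fix a assume "a \<notin> ?n"
    then have ay: "a * y \<notin> N" using in_n by blast
    let ?X = "ideal_gen (insert (a * y) N)"
    have "?X \<subseteq> J" using isN(3) yJ by (intro ideal_gen_minimal isJ) (auto intro: ideal_mult_left[OF isJ])
    moreover have "N \<subseteq> ?X" "a * y \<in> ?X" by (auto intro: ideal_gen_base)
    ultimately have "y \<in> ?X"
      using maxN[of ?X] ay isN(2) is_ideal_ideal_gen by (auto simp: \<A>_def)
    then obtain k where "y - k * (a * y) \<in> N"
      using isN(1) by (auto simp: ideal_gen_insert ideal_gen_ideal)
    from ideal_uminus[OF isN(1) this]
    have "k * a - 1 \<in> ?n" by (intro in_n) (simp add: algebra_simps)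
    then show "\<exists>a'. a' * a - 1 \<in> ?n" by blast
  qed
  then show thesis
    using that[OF isN(1) _ isN(3) yJ isN(4)] K'(2) isN(2) Jy by blast
qed

text \<open>More vectors than generators are linearly dependent.  This is elimination over the residue field
  $R/\mathfrak n$, carried out in the ring with inverses modulo \<open>n\<close>.\<close>

lemma dependent_mod_maximal_ideal:
  assumes n: "maximal_ideal n" and P: "is_ideal P"
    and fin: "finite Y" and "finite X" and "card Y < card X"
    and "\<And>a y. a \<in> n \<Longrightarrow> y \<in> Y \<Longrightarrow> a * y \<in> P"
    and "\<And>x. x \<in> X \<Longrightarrow> w x \<in> ideal_gen (Y \<union> P)"
  shows "\<exists>c. (\<exists>x\<in>X. c x \<notin> n) \<and> (\<Sum>x\<in>X. c x * w x) \<in> P"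
  using fin assms(4-)
proof (induction Y arbitrary: X w)
  case empty
  then obtain x where x: "x \<in> X" by fastforce
  have "(\<Sum>x\<in>X. 1 * w x) \<in> P"
    using empty P by (intro ideal_sum) (auto simp: ideal_gen_ideal)
  then show ?case using x n by (intro exI[of _ "\<lambda>_. 1"]) (auto simp: maximal_ideal_def)
next
  case (insert y Y)
  have "\<exists>k. w x - k * y \<in> ideal_gen (Y \<union> P)" if "x \<in> X" for x
    using insert.prems(4)[OF that] by (simp add: ideal_gen_insert)
  then obtain k where k: "\<And>x. x \<in> X \<Longrightarrow> w x - k x * y \<in> ideal_gen (Y \<union> P)" by metis
  show ?case
  proof (cases "\<forall>x\<in>X. k x \<in> n")
    case True
    have "w x \<in> ideal_gen (Y \<union> P)" if "x \<in> X" for x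
    proof -
      have "k x * y \<in> ideal_gen (Y \<union> P)" using True that insert.prems(3) by (intro ideal_gen_base) auto
      from ideal_gen_add[OF k[OF that] this] show ?thesis by simp
    qed
    then show ?thesis using insert by (intro insert.IH) auto
  next
    case False
    then obtain x0 where x0: "x0 \<in> X" "k x0 \<notin> n" by blast
    obtain u where u: "u * k x0 - 1 \<in> n" using x0 n by (auto simp: maximal_ideal_def)
    define w' where "w' x = w x - k x * u * w x0" for x
    have "w' x \<in> ideal_gen (Y \<union> P)" if "x \<in> X - {x0}" for x
    proof -
      have "w' x = (w x - k x * y) - (k x * u) * (w x0 - k x0 * y) - k x * ((u * k x0 - 1) * y)"
        by (simp add: w'_def algebra_simps)
      also have "\<dots> \<in> ideal_gen (Y \<union> P)"
      proof (rule ideal_gen_diff[OF ideal_gen_diff])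
        show "w x - k x * y \<in> ideal_gen (Y \<union> P)" using that k by blast
        show "k x * u * (w x0 - k x0 * y) \<in> ideal_gen (Y \<union> P)"
          using x0 k by (intro ideal_gen_mult_left)
        show "k x * ((u * k x0 - 1) * y) \<in> ideal_gen (Y \<union> P)"
          using u insert.prems(3) by (intro ideal_gen_mult_left ideal_gen_base) auto
      qed
      finally show ?thesis .
    qed
    then have "\<exists>c. (\<exists>x\<in>X - {x0}. c x \<notin> n) \<and> (\<Sum>x\<in>X - {x0}. c x * w' x) \<in> P"
      using insert x0 by (intro insert.IH) auto
    then obtain c x1 where c: "x1 \<in> X - {x0}" "c x1 \<notin> n" "(\<Sum>x\<in>X - {x0}. c x * w' x) \<in> P" by blast
    define c' where "c' x = (if x = x0 then - (\<Sum>x\<in>X - {x0}. c x * k x * u) else c x)" for x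
    have "(\<Sum>x\<in>X. c' x * w x) = c' x0 * w x0 + (\<Sum>x\<in>X - {x0}. c x * w x)"
      using x0 insert.prems(1) by (subst sum.remove[of _ x0]) (auto simp: c'_def)
    also have "\<dots> = (\<Sum>x\<in>X - {x0}. c x * w' x)"
      by (simp add: c'_def w'_def sum_distrib_left sum_subtractf algebra_simps)
    finally have "(\<Sum>x\<in>X. c' x * w x) \<in> P" using c(3) by simp
    moreover have "c' x1 \<notin> n" "x1 \<in> X" using c by (auto simp: c'_def)
    ultimately show ?thesis by blast
  qed
qed

text \<open>For $c = |A| \ge 1$ and $r = 0$ the sizes are ${c+k-1 \choose k}$ and ${c+k \choose c}$, with quotient $(c+k)/c$,
  which is unbounded in $k$; a positive $r$ only increases the second.\<close>

lemma multisets_outgrow_one_element_fewer: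
  assumes "finite A" and "a \<notin> A"
  obtains k where "q * card (multisets_of_size A k) < card (multisets_of_size (insert a A) (r + k))"
proof -
  define c where "c = card A"
  define k where "k = Suc (q * c)"
  have big: "card (multisets_of_size (insert a A) (r + k)) = (c + (r + k)) choose c"
    using assms by (simp add: card_multisets_of_size c_def binomial_symmetric[of "r + k"])
  have "q * ((c + k - 1) choose k) < ((c + k) choose c)"
  proof (cases c)
    case (Suc c')
    have "c * ((c + k) choose c) = (c + k) * ((c + k - 1) choose (c - 1))"
      using Suc by (intro times_binomial_minus1_eq) simp
    also have "(c + k - 1) choose (c - 1) = (c + k - 1) choose k"
      using binomial_symmetric[of k "c + k - 1"] Suc by simp
    also have "(c + k) * ((c + k - 1) choose k) > (q * c) * ((c + k - 1) choose k)"
    proof (rule mult_strict_right_mono)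
      show "q * c < c + k" by (simp add: k_def)
      show "0 < (c + k - 1) choose k" using Suc by (intro zero_less_binomial) simp
    qed
    finally have "c * (q * ((c + k - 1) choose k)) < c * ((c + k) choose c)"
      by (simp add: ac_simps)
    then show ?thesis by (rule mult_less_cancel1[THEN iffD1, THEN conjunct2])
  qed (simp add: k_def binomial_eq_0)
  also have "\<dots> \<le> (c + (r + k)) choose c" by (intro binomial_right_mono) simp
  finally show thesis
    using that[of k] assms(1) by (simp add: big card_multisets_of_size c_def)
qed


context form_family
begin

section \<open>The polar ideal near a flat\<close>

text \<open>$\theta_F(\varphi)$ depends only on the values of \<open>\<phi>\<close> on a basis of \<open>F\<close>; hence \<open>polar_ideal\<close> is generated by as
  many elements as the rank.\<close>

lemma polar_expand:
  assumes B: "independent B" "finite B" and F: "L \<inter> F \<subseteq> span B" and \<phi>: "functional \<phi>"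
  shows "polar F \<phi> = (\<Sum>b\<in>B. scale (\<phi> b) (polar F (coord B b)))"
proof -
  have "\<phi> a = (\<Sum>b\<in>B. \<phi> b * coord B b a)" if "a \<in> L \<inter> F" for a
  proof -
    have "\<phi> a = \<phi> (\<Sum>b\<in>B. scale (coord B b a) b)"
      using coord_sum[OF B] that F by auto
    also have "\<dots> = (\<Sum>b\<in>B. coord B b a * \<phi> b)"
      by (simp add: module_hom.sum[OF module_hom_linearI[OF \<phi>]] module_hom.scale[OF module_hom_linearI[OF \<phi>]])
    finally show ?thesis by (simp add: mult.commute)
  qed
  then have "polar F \<phi> = (\<Sum>a\<in>L \<inter> F. \<Sum>b\<in>B. scale (\<phi> b) (scale (coord B b a) (cofactor a)))"
    unfolding polar_def by (intro sum.cong refl) (simp add: scale_sum_left)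
  then show ?thesis
    unfolding polar_def by (subst (asm) sum.swap) (simp add: scale_sum_right)
qed

lemma polar_in_ideal: "functional \<phi> \<Longrightarrow> polar UNIV \<phi> \<in> polar_ideal"
  unfolding polar_ideal_def by (rule ideal_gen_base) blast

lemma is_ideal_polar_ideal: "is_ideal polar_ideal"
  by (simp add: polar_ideal_def is_ideal_ideal_gen)

lemma polar_ideal_finite:
  obtains G where "finite G" and "polar_ideal = ideal_gen G"
proof -
  obtain B where B: "B \<subseteq> L" "independent B" "L \<subseteq> span B"
    using maximal_independent_subset by blast
  have fB: "finite B" using B(1) finite_forms finite_subset by blast
  let ?G = "(\<lambda>b. polar UNIV (coord B b)) ` B"
  have "polar UNIV \<phi> \<in> ideal_gen ?G" if "functional \<phi>" for \<phi>
    using B fB that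
    by (subst polar_expand[of B])
      (auto intro!: ideal_gen_sum ideal_scale_closed is_ideal_ideal_gen intro: ideal_gen_base)
  then have "polar_ideal \<subseteq> ideal_gen ?G"
    unfolding polar_ideal_def by (intro ideal_gen_minimal is_ideal_ideal_gen) blast
  moreover have "ideal_gen ?G \<subseteq> polar_ideal"
    using B functional_coord
    by (intro ideal_gen_minimal is_ideal_polar_ideal) (auto intro: polar_in_ideal)
  ultimately show thesis using fB that[of ?G] by auto
qed

lemma polar_ideal_subset: "polar_ideal \<subseteq> cofactor_ideal"
proof -
  have "polar UNIV \<phi> \<in> cofactor_ideal" for \<phi>
    unfolding polar_def cofactor_ideal_def
    by (intro ideal_gen_sum ideal_scale_closed is_ideal_ideal_gen) (auto intro: ideal_gen_base)
  then show ?thesis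
    unfolding polar_ideal_def cofactor_ideal_def[symmetric]
    by (intro ideal_gen_minimal) (auto simp: cofactor_ideal_def is_ideal_ideal_gen)
qed

lemma defining_in_polar_ideal:
  assumes "L \<noteq> {}"
  shows "\<Prod>L \<in> polar_ideal"
proof -
  obtain B where B: "B \<subseteq> L" "independent B" "L \<subseteq> span B"
    using maximal_independent_subset by blast
  have fB: "finite B" using B(1) finite_forms finite_subset by blast
  have "scale (of_nat (card L)) (\<Prod>L) = (\<Sum>b\<in>B. b * polar UNIV (coord B b))"
    using euler_flat[OF B(2) fB, of UNIV] B(3) by simp
  also have "\<dots> \<in> polar_ideal"
    using functional_coord[OF B(2)]
    by (intro ideal_sum ideal_mult_left is_ideal_polar_ideal polar_in_ideal)
  finally have "scale (1 / of_nat (card L)) (scale (of_nat (card L)) (\<Prod>L)) \<in> polar_ideal"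
    by (rule ideal_scale_closed[OF is_ideal_polar_ideal])
  then show ?thesis using assms finite_forms by simp
qed

lemma not_mem_maximal_scale:
  assumes "maximal_ideal n" and "x \<notin> n" and "c \<noteq> 0"
  shows "scale c x \<notin> n"
proof
  assume "scale c x \<in> n"
  then have "scale (1 / c) (scale c x) \<in> n"
    by (rule ideal_scale_closed[OF maximal_ideal_is_ideal[OF assms(1)]])
  then show False using assms by simp
qed

text \<open>Near \<open>n\<close> the arrangement looks like the arrangement of the forms that lie in \<open>n\<close>: the product \<open>u\<close> of the
  other forms is a unit.  Euler's identity for \<open>B\<close> gives $f \in \mathfrak n J$ locally, because its correction
  terms, from the forms outside \<open>n\<close>, are multiples of $f$ by elements of \<open>n\<close> after multiplication by \<open>u\<close>.
  If \<open>\<phi>\<close> kills \<open>B\<close>, then $u\,\theta(\varphi)$ is a multiple of $f$, so $\theta(\varphi)$ is redundant.\<close>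

lemma polar_ideal_local_generators:
  assumes n: "maximal_ideal n" and N: "is_ideal N"
    and nJ: "\<And>a x. a \<in> n \<Longrightarrow> x \<in> polar_ideal \<Longrightarrow> a * x \<in> N"
    and B: "independent B" "B \<subseteq> L \<inter> n" "L \<inter> n \<subseteq> span B" and ne: "L \<inter> n \<noteq> {}"
    and gen: "\<And>b. b \<in> B \<Longrightarrow> polar UNIV (coord B b) \<in> N"
  shows "polar_ideal \<subseteq> N"
proof -
  let ?T = "L \<inter> n" and ?U = "L - n"
  let ?u = "\<Prod>?U" and ?f = "\<Prod>L"
  have isn: "is_ideal n" using n by (rule maximal_ideal_is_ideal)
  have fB: "finite B" using B(2) finite_forms finite_subset by blast
  have u: "?u \<notin> n" using maximal_ideal_prod_iff[OF n, of ?U] finite_forms by auto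
  have uc: "?u * cofactor a = ?f * \<Prod>(?U - {a})" if "a \<in> ?U" for a
  proof -
    have "?u * cofactor a = (a * cofactor a) * \<Prod>(?U - {a})"
      using that finite_forms by (subst prod.remove[of _ a]) (auto simp: ac_simps)
    then show ?thesis using that mult_cofactor by auto
  qed
  have split: "sum g L = sum g ?T + sum g ?U" for g :: "'a \<Rightarrow> 'a"
    using finite_forms by (metis sum.Int_Diff)
  define pr where "pr a = (\<Sum>b\<in>B. scale (coord B b a) b)" for a
  have prn: "pr a \<in> n" for a
    unfolding pr_def using B(2) isn by (intro ideal_sum ideal_scale_closed) auto
  have prT: "pr a = a" if "a \<in> ?T" for a
    unfolding pr_def using coord_sum[OF B(1) fB] that B(3) by blast
  define s where "s = scale (of_nat (card ?T)) ?u + (\<Sum>a\<in>?U. \<Prod>(?U - {a}) * pr a)"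
  \<comment> \<open>Euler's identity along the flat exhibits \<open>f\<close>, up to a unit at \<open>n\<close>, in \<open>n J\<close>.\<close>
  have "?u * (\<Sum>b\<in>B. b * polar UNIV (coord B b)) = ?u * (\<Sum>a\<in>L. cofactor a * pr a)"
    using sum_basis_mult_polar[OF B(1) fB, of UNIV] by (simp add: pr_def)
  also have "\<dots> = ?u * (\<Sum>a\<in>?T. cofactor a * a) + (\<Sum>a\<in>?U. (?u * cofactor a) * pr a)"
    by (simp add: split prT distrib_left sum_distrib_left ac_simps)
  also have "(\<Sum>a\<in>?T. cofactor a * a) = (\<Sum>a\<in>?T. ?f)"
    by (intro sum.cong refl) (auto simp: mult.commute mult_cofactor)
  also have "\<dots> = scale (of_nat (card ?T)) ?f"
    by (rule sum_constant_scale)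
  also have "(\<Sum>a\<in>?U. (?u * cofactor a) * pr a) = ?f * (\<Sum>a\<in>?U. \<Prod>(?U - {a}) * pr a)"
    by (simp add: uc sum_distrib_left mult.assoc)
  also have "?u * scale (of_nat (card ?T)) ?f + \<dots> = s * ?f"
    by (simp add: s_def algebra_simps mult_scale scale_mult)
  finally have eq: "s * ?f = ?u * (\<Sum>b\<in>B. b * polar UNIV (coord B b))" by simp
  have "s * ?f \<in> N"
    unfolding eq using B(2) functional_coord[OF B(1)]
    by (intro ideal_mult_left N ideal_sum nJ polar_in_ideal) auto
  moreover have "s \<notin> n"
  proof
    have "of_nat (card ?T) \<noteq> (0::'k)" using ne finite_forms by simp
    then have "scale (of_nat (card ?T)) ?u \<notin> n" by (rule not_mem_maximal_scale[OF n u])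
    moreover assume "s \<in> n"
    moreover have "(\<Sum>a\<in>?U. \<Prod>(?U - {a}) * pr a) \<in> n"
      by (intro ideal_sum isn ideal_mult_left prn)
    ultimately show False using ideal_diff[OF isn, of s] unfolding s_def by fastforce
  qed
  moreover have "L \<noteq> {}" using ne by blast
  ultimately have f: "?f \<in> N"
    using maximal_ideal_unit_cancel[OF n _ _ N nJ, of s ?f] defining_in_polar_ideal by blast
  have "polar UNIV \<phi> \<in> N" if \<phi>: "functional \<phi>" for \<phi>
  proof -
    let ?w = "\<Sum>b\<in>B. scale (\<phi> b) (polar UNIV (coord B b))"
    define v where "v = polar UNIV \<phi> - ?w"
    have w: "?w \<in> N" by (intro ideal_sum N ideal_scale_closed gen)
    have "?w \<in> polar_ideal"
      using functional_coord[OF B(1)]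
      by (intro ideal_sum is_ideal_polar_ideal ideal_scale_closed polar_in_ideal)
    then have vJ: "v \<in> polar_ideal"
      unfolding v_def using \<phi> by (intro ideal_diff is_ideal_polar_ideal polar_in_ideal)
    have part: "polar UNIV \<psi> = polar n \<psi> + (\<Sum>a\<in>?U. scale (\<psi> a) (cofactor a))" for \<psi>
      by (rule polar_split)
    have "v = (\<Sum>a\<in>?U. scale (\<phi> a) (cofactor a))
              - (\<Sum>b\<in>B. scale (\<phi> b) (\<Sum>a\<in>?U. scale (coord B b a) (cofactor a)))"
      unfolding v_def part[of \<phi>] part[of "coord B _"] polar_expand[OF B(1) fB B(3) \<phi>]
      by (simp add: scale_right_distrib sum.distrib)
    then have "?u * v = (\<Sum>a\<in>?U. scale (\<phi> a) (?f * \<Prod>(?U - {a})))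
              - (\<Sum>b\<in>B. scale (\<phi> b) (\<Sum>a\<in>?U. scale (coord B b a) (?f * \<Prod>(?U - {a}))))"
      by (simp add: right_diff_distrib sum_distrib_left mult_scale uc)
    also have "\<dots> \<in> N"
      using f by (intro ideal_diff ideal_sum N ideal_scale_closed ideal_mult_right)
    finally have "v \<in> N"
      using maximal_ideal_unit_cancel[OF n u _ N nJ, of v] vJ by blast
    from ideal_add[OF N this w] show ?thesis by (simp add: v_def)
  qed
  then show ?thesis
    unfolding polar_ideal_def by (intro ideal_gen_minimal N) blast
qed

end


section \<open>Orders of vanishing modulo a maximal ideal\<close>

text \<open>The order of vanishing of a polynomial in one variable over $R$, read modulo \<open>n\<close>.\<close>

definition vanishing_mod :: "'a::comm_ring_1 set \<Rightarrow> nat \<Rightarrow> 'a poly \<Rightarrow> bool"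
  where "vanishing_mod n k p \<longleftrightarrow> (\<forall>i<k. coeff p i \<in> n)"

definition exact_order :: "'a::comm_ring_1 set \<Rightarrow> nat \<Rightarrow> 'a poly \<Rightarrow> bool"
  where "exact_order n k p \<longleftrightarrow> vanishing_mod n k p \<and> coeff p k \<notin> n"

lemma vanishing_mod_mult:
  assumes "is_ideal n" and "vanishing_mod n k p" and "vanishing_mod n l q"
  shows "vanishing_mod n (k + l) (p * q)"
  unfolding vanishing_mod_def
proof (intro allI impI)
  fix j assume j: "j < k + l"
  show "coeff (p * q) j \<in> n"
    unfolding coeff_mult
  proof (intro ideal_sum assms(1))
    fix i assume "i \<in> {..j}"
    then have "i < k \<or> j - i < l" using j by auto
    then show "coeff p i * coeff q (j - i) \<in> n"
      using assms by (auto simp: vanishing_mod_def intro: ideal_mult_left ideal_mult_right)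
  qed
qed

lemma vanishing_mod_mono: "vanishing_mod n k p \<Longrightarrow> l \<le> k \<Longrightarrow> vanishing_mod n l p"
  by (auto simp: vanishing_mod_def)

text \<open>Exact orders add because a maximal ideal is prime, so the product of the two leading coefficients
  is again outside \<open>n\<close>.\<close>

lemma exact_order_mult:
  assumes n: "maximal_ideal n" and p: "exact_order n k p" and q: "exact_order n l q"
  shows "exact_order n (k + l) (p * q)"
proof -
  have isn: "is_ideal n" using n by (rule maximal_ideal_is_ideal)
  have "coeff (p * q) (k + l)
        = coeff p k * coeff q l + (\<Sum>i\<in>{..k + l} - {k}. coeff p i * coeff q (k + l - i))"
    unfolding coeff_mult by (subst sum.remove[of _ k]) auto
  moreover have "(\<Sum>i\<in>{..k + l} - {k}. coeff p i * coeff q (k + l - i)) \<in> n"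
  proof (intro ideal_sum isn)
    fix i assume "i \<in> {..k + l} - {k}"
    then have "i < k \<or> k + l - i < l" by auto
    then show "coeff p i * coeff q (k + l - i) \<in> n"
      using p q isn by (auto simp: exact_order_def vanishing_mod_def intro: ideal_mult_left ideal_mult_right)
  qed
  moreover have "coeff p k * coeff q l \<notin> n"
    using p q by (simp add: maximal_ideal_mult_iff[OF n] exact_order_def)
  ultimately have "coeff (p * q) (k + l) \<notin> n"
    using ideal_diff_mem_iff[OF isn, of "coeff (p * q) (k + l)" "coeff p k * coeff q l"] by simp
  then show ?thesis
    using p q vanishing_mod_mult[OF isn] by (simp add: exact_order_def)
qed

lemma exact_order_1: "maximal_ideal n \<Longrightarrow> exact_order n 0 1"
  by (simp add: exact_order_def vanishing_mod_def maximal_ideal_def)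

lemma exact_order_prod:
  assumes "maximal_ideal n" and "finite A" and "\<And>a. a \<in> A \<Longrightarrow> exact_order n (k a) (p a)"
  shows "exact_order n (\<Sum>a\<in>A. k a) (\<Prod>a\<in>A. p a)"
  using assms(2,3)
  by (induction A) (auto simp: exact_order_1[OF assms(1)] intro!: exact_order_mult[OF assms(1)])

lemma exact_order_prod_mset:
  assumes "maximal_ideal n" and "\<And>a. a \<in># M \<Longrightarrow> exact_order n (k a) (p a)"
  shows "exact_order n (\<Sum>a\<in>#M. k a) (\<Prod>a\<in>#M. p a)"
  using assms(2)
  by (induction M) (auto simp: exact_order_1[OF assms(1)] intro!: exact_order_mult[OF assms(1)])

lemma digits_unique:
  fixes f g :: "nat \<Rightarrow> nat"
  assumes "(\<Sum>i<N. f i * q ^ i) = (\<Sum>i<N. g i * q ^ i)" and "\<And>i. f i < q" and "\<And>i. g i < q"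
  shows "\<forall>i<N. f i = g i"
  using assms
proof (induction N arbitrary: f g)
  case (Suc N)
  have shift: "(\<Sum>i<Suc N. h i * q ^ i) = h 0 + q * (\<Sum>i<N. h (Suc i) * q ^ i)" for h
    by (subst sum.lessThan_Suc_shift) (simp add: sum_distrib_left ac_simps)
  have eq: "f 0 + q * (\<Sum>i<N. f (Suc i) * q ^ i) = g 0 + q * (\<Sum>i<N. g (Suc i) * q ^ i)"
    using Suc.prems(1) unfolding shift .
  have "f 0 = g 0"
    using arg_cong[OF eq, of "\<lambda>x. x mod q"] Suc.prems(2,3)[of 0] by simp
  moreover have "q > 0" using Suc.prems(2)[of 0] by simp
  ultimately have "\<forall>i<N. f (Suc i) = g (Suc i)"
    using eq Suc.prems(2,3) by (intro Suc.IH) auto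
  with \<open>f 0 = g 0\<close> show ?case by (auto simp: less_Suc_eq_0_disj)
qed simp

text \<open>Multiplicities of a multiset of size \<open>d < q\<close> are the base-\<open>q\<close> digits of its weight, so weights separate
  multisets.\<close>

lemma sum_powers_determine_multiset:
  assumes "inj_on e A" and "finite A" and "M \<in> multisets_of_size A d" and "M' \<in> multisets_of_size A d"
    and q: "d < q" and eq: "(\<Sum>a\<in>#M. q ^ e a) = (\<Sum>a\<in>#M'. q ^ e a)"
  shows "M = M'"
proof -
  obtain N where N: "\<And>a. a \<in> A \<Longrightarrow> e a < N"
    using assms(2) finite_nat_set_iff_bounded[of "e ` A"] by auto
  have expand: "(\<Sum>i\<in>#K. q ^ i) = (\<Sum>i<N. count K i * q ^ i)" if "set_mset K \<subseteq> {..<N}" for K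
    using that
  proof (induction K)
    case (add j K)
    have "(\<Sum>i<N. count (add_mset j K) i * q ^ i)
          = (\<Sum>i<N. count K i * q ^ i + (if i = j then q ^ j else 0))"
      by (intro sum.cong) auto
    also have "\<dots> = (\<Sum>i<N. count K i * q ^ i) + q ^ j"
      using add.prems by (simp add: sum.distrib)
    finally show ?case using add by simp
  qed simp
  have sub: "set_mset (image_mset e K) \<subseteq> {..<N}" "size (image_mset e K) = d"
    if "K \<in> multisets_of_size A d" for K
    using that N by (auto simp: multisets_of_size_def)
  have cnt: "count (image_mset e K) i < q" if "K \<in> multisets_of_size A d" for K i
    using count_le_size[of "image_mset e K" i] sub(2)[OF that] q by simp
  have "(\<Sum>i<N. count (image_mset e M) i * q ^ i) = (\<Sum>i<N. count (image_mset e M') i * q ^ i)"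
    using eq expand[OF sub(1)[OF assms(3)]] expand[OF sub(1)[OF assms(4)]]
    by (simp add: multiset.map_comp o_def)
  from digits_unique[OF this cnt[OF assms(3)] cnt[OF assms(4)]]
  have "count (image_mset e M) i = count (image_mset e M') i" for i
  proof (cases "i < N")
    case False
    then have "i \<notin># image_mset e M" "i \<notin># image_mset e M'"
      using sub(1)[OF assms(3)] sub(1)[OF assms(4)] by blast+
    then show ?thesis by (simp only: not_in_iff)
  qed blast
  then have "image_mset e M = image_mset e M'" by (simp add: multiset_eq_iff)
  moreover have "image_mset (the_inv_into A e) (image_mset e K) = K" if "K \<in> multisets_of_size A d" for K
  proof -
    have "image_mset (the_inv_into A e) (image_mset e K) = image_mset (\<lambda>a. a) K"
      unfolding multiset.map_comp o_def
      using that assms(1) by (intro image_mset_cong) (auto simp: multisets_of_size_def the_inv_into_f_f subset_iff)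
    then show ?thesis by simp
  qed
  ultimately show ?thesis using assms(3,4) by metis
qed

section \<open>Independence of cofactor monomials\<close>

context form_family
begin

text \<open>An arc through the generic point, moving the forms off \<open>n\<close> at different speeds: the form \<open>b\<close> of \<open>B\<close> is moved
  by $s^{w_b}$.  The \<open>W\<close> records that nothing moves below order \<open>W\<close>.\<close>

definition deformation :: "'a set \<Rightarrow> ('a \<Rightarrow> nat) \<Rightarrow> nat \<Rightarrow> ('a \<Rightarrow> 'a poly) \<Rightarrow> bool"
  where "deformation B w W \<tau> \<longleftrightarrow>
    \<tau> 1 = 1 \<and> (\<forall>x y. \<tau> (x + y) = \<tau> x + \<tau> y) \<and> (\<forall>x y. \<tau> (x * y) = \<tau> x * \<tau> y) \<and>
    (\<forall>x. coeff (\<tau> x) 0 = x) \<and> (\<forall>x i. 0 < i \<and> i < W \<longrightarrow> coeff (\<tau> x) i = 0) \<and>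
    (\<forall>a\<in>L. \<tau> a = [:a:] + (\<Sum>b\<in>B. monom (scale (coord B b a) 1) (w b)))"

lemma deformation_prod:
  assumes "deformation B w W \<tau>"
  shows "\<tau> (\<Prod>A) = (\<Prod>a\<in>A. \<tau> a)"
  using assms by (induction A rule: infinite_finite_induct) (auto simp: deformation_def)

lemma deformation_prod_mset:
  assumes "deformation B w W \<tau>"
  shows "\<tau> (\<Prod>a\<in>#M. g a) = (\<Prod>a\<in>#M. \<tau> (g a))"
  using assms by (induction M) (auto simp: deformation_def)

lemma deformation_sum:
  assumes "deformation B w W \<tau>"
  shows "\<tau> (\<Sum>x\<in>A. g x) = (\<Sum>x\<in>A. \<tau> (g x))"
proof -
  have "\<tau> 0 + \<tau> 0 = \<tau> 0" using assms unfolding deformation_def by (metis add.right_neutral)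
  then have "\<tau> 0 = 0" by simp
  then show ?thesis
    using assms by (induction A rule: infinite_finite_induct) (auto simp: deformation_def)
qed

text \<open>A form outside \<open>n\<close> has order zero.  A form in \<open>n\<close> lies in the span of \<open>B\<close>, and as the weights are distinct
  each of its nonzero coordinates is visible as a coefficient that is a unit.\<close>

lemma deformation_order_form:
  assumes n: "maximal_ideal n" and B: "independent B" "finite B" "L \<inter> n \<subseteq> span B"
    and \<tau>: "deformation B w W \<tau>" and w: "inj_on w B" "\<And>b. b \<in> B \<Longrightarrow> 0 < w b \<and> w b \<le> V"
    and a: "a \<in> L"
  shows "\<exists>k\<le>V. exact_order n k (\<tau> a)"
proof -
  have \<tau>a: "\<tau> a = [:a:] + (\<Sum>b\<in>B. monom (scale (coord B b a) 1) (w b))"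
    using \<tau> a by (simp add: deformation_def)
  have "\<exists>k\<le>V. coeff (\<tau> a) k \<notin> n"
  proof (cases "a \<in> n")
    case False
    then show ?thesis using \<tau> by (intro exI[of _ 0]) (auto simp: deformation_def)
  next
    case True
    have "a \<noteq> 0"
    proof
      assume "a = 0"
      then have "(1::'a) = 0" using form_cancel[OF a, of 1] by simp
      then show False using n ideal_zero[of n] by (auto simp: maximal_ideal_def)
    qed
    moreover have "a \<in> span B" using True a B(3) by blast
    ultimately obtain b where b: "b \<in> B" "coord B b a \<noteq> 0"
      using coord_sum[OF B(1,2)] by (metis (no_types, lifting) scale_zero_left sum.neutral)
    have "coeff [:a:] (w b) = 0" using w(2)[OF b(1)] by (simp add: coeff_pCons split: nat.split)
    then have "coeff (\<tau> a) (w b) = (\<Sum>b'\<in>B. if b' = b then scale (coord B b a) 1 else 0)"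
      unfolding \<tau>a coeff_add coeff_sum using b inj_on_eq_iff[OF w(1)]
      by (auto intro!: sum.cong)
    also have "\<dots> = scale (coord B b a) 1" using b B by simp
    also have "\<dots> \<notin> n"
      using n b by (intro not_mem_maximal_scale) (auto simp: maximal_ideal_def)
    finally show ?thesis using w b by blast
  qed
  then obtain k where k: "k \<le> V" "coeff (\<tau> a) k \<notin> n" by blast
  define l where "l = (LEAST k. coeff (\<tau> a) k \<notin> n)"
  have "coeff (\<tau> a) l \<notin> n" "l \<le> k" unfolding l_def by (rule LeastI[where P = "\<lambda>k. coeff (\<tau> a) k \<notin> n", OF k(2)], rule Least_le[where P = "\<lambda>k. coeff (\<tau> a) k \<notin> n", OF k(2)])
  moreover have "vanishing_mod n l (\<tau> a)" unfolding vanishing_mod_def l_def using not_less_Least by blast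
  ultimately show ?thesis using k(1) by (intro exI[of _ l]) (simp add: exact_order_def)
qed

lemma deformation_order_basis:
  assumes n: "maximal_ideal n" and B: "independent B" "finite B" "B \<subseteq> L \<inter> n"
    and \<tau>: "deformation B w W \<tau>" and w: "0 < w b" and b: "b \<in> B"
  shows "exact_order n (w b) (\<tau> b)"
proof -
  have "\<tau> b = [:b:] + (\<Sum>b'\<in>B. monom (scale (coord B b' b) 1) (w b'))"
    using \<tau> b B by (auto simp: deformation_def)
  also have "(\<Sum>b'\<in>B. monom (scale (coord B b' b) 1) (w b')) = (\<Sum>b'\<in>B. if b' = b then monom 1 (w b) else 0)"
    using coord_basis[OF B(1) _ b] by (intro sum.cong) auto
  also have "\<dots> = monom 1 (w b)" using B b by simp
  finally have \<tau>b: "\<tau> b = [:b:] + monom 1 (w b)" .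
  have "coeff (\<tau> b) i \<in> n" if "i < w b" for i
    using that b B(3) ideal_zero[OF maximal_ideal_is_ideal[OF n]] unfolding \<tau>b by (auto simp: coeff_pCons split: nat.split)
  moreover have "coeff (\<tau> b) (w b) = 1"
    using w unfolding \<tau>b by (auto simp: coeff_pCons split: nat.split)
  ultimately show ?thesis
    using n by (simp add: exact_order_def vanishing_mod_def maximal_ideal_def)
qed

lemma vanishing_mod_deformation_ideal:
  assumes n: "maximal_ideal n" and \<tau>: "deformation B w W \<tau>"
  shows "is_ideal {x. vanishing_mod n k (\<tau> x)}"
proof -
  have isn: "is_ideal n" using n by (rule maximal_ideal_is_ideal)
  have "\<tau> 0 = 0" using deformation_sum[OF \<tau>, of _ "{}"] by simp
  moreover have "vanishing_mod n k (\<tau> (c * x))" if "vanishing_mod n k (\<tau> x)" for c x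
    using \<tau> vanishing_mod_mult[OF isn _ that, of 0 "\<tau> c"] by (simp add: deformation_def vanishing_mod_def)
  ultimately show ?thesis
    unfolding is_ideal_def module.subspace_def[OF module_mult]
    using \<tau> ideal_zero[OF isn] ideal_add[OF isn] by (auto simp: deformation_def vanishing_mod_def)
qed

text \<open>The weights are $w_b = W + (d+2)^{e_b}$ with distinct $e_b$.  The second summand makes the orders of distinct
  monomials in the cofactors of \<open>B\<close> distinct.  The common summand \<open>W\<close> is so large that these orders exceed the least
  possible order of a monomial of degree \<open>d\<close> in the cofactors of \<open>L\<close> by less than \<open>W\<close>, whereas a coefficient
  in \<open>n\<close> raises the order by at least \<open>W\<close>.  So the term of least order among those with coefficient
  outside \<open>n\<close> is cancelled neither by the other terms nor by $\mathfrak n I^d$.\<close>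

lemma cofactors_independent_mod:
  assumes n: "maximal_ideal n" and B: "independent B" "B \<subseteq> L \<inter> n" "L \<inter> n \<subseteq> span B"
    and deform: "\<And>w W. 0 < W \<Longrightarrow> (\<And>b. b \<in> B \<Longrightarrow> W \<le> w b) \<Longrightarrow> \<exists>\<tau>. deformation B w W \<tau>"
    and rel: "(\<Sum>M\<in>multisets_of_size B d. c M * cofactors M)
              \<in> ideal_gen {a * x |a x. a \<in> n \<and> x \<in> ideal_power cofactor_ideal d}"
    and M: "M \<in> multisets_of_size B d"
  shows "c M \<in> n"
proof (rule ccontr)
  assume cM: "c M \<notin> n"
  have isn: "is_ideal n" using n by (rule maximal_ideal_is_ideal)
  have fB: "finite B" using B(2) finite_forms finite_subset by blast
  obtain e :: "'a \<Rightarrow> nat" where e: "inj_on e B" using fB finite_imp_inj_to_nat_seg by metis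
  obtain E where E: "\<And>b. b \<in> B \<Longrightarrow> (d + 2) ^ e b \<le> E"
    using fB finite_nat_set_iff_bounded_le[of "(\<lambda>b. (d + 2) ^ e b) ` B"] by auto
  define W where "W = Suc (d * E)"
  define w where "w b = W + (d + 2) ^ e b" for b
  have w: "0 < W \<and> W \<le> w b" "w b \<le> W + E" if "b \<in> B" for b
    using E[OF that] by (auto simp: w_def W_def)
  obtain \<tau> where \<tau>: "deformation B w W \<tau>" using deform[of W w] w(1) by (auto simp: W_def)
  have \<tau>_mult: "\<tau> (x * y) = \<tau> x * \<tau> y" for x y using \<tau> by (simp add: deformation_def)
  have "\<exists>k. k \<le> W + E \<and> exact_order n k (\<tau> a) \<and> (a \<in> B \<longrightarrow> k = w a)" if a: "a \<in> L" for a
  proof (cases "a \<in> B")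
    case True
    then show ?thesis
      using deformation_order_basis[OF n B(1) fB B(2) \<tau> _ True] w[OF True] by auto
  next
    case False
    have "inj_on w B" using e by (auto simp: inj_on_def w_def power_inject_exp)
    then show ?thesis
      using deformation_order_form[OF n B(1) fB B(3) \<tau> _ _ a, of "W + E"] w False by fastforce
  qed
  then have "\<exists>ord. \<forall>a\<in>L. ord a \<le> W + E \<and> exact_order n (ord a) (\<tau> a) \<and> (a \<in> B \<longrightarrow> ord a = w a)"
    by (intro bchoice) blast
  then obtain ord where ord: "\<And>a. a \<in> L \<Longrightarrow> ord a \<le> W + E"
      "\<And>a. a \<in> L \<Longrightarrow> exact_order n (ord a) (\<tau> a)" "\<And>b. b \<in> B \<Longrightarrow> ord b = w b"
    using B(2) by blast
  define \<Omega> where "\<Omega> = sum ord L"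
  define \<kappa> where "\<kappa> a = sum ord (L - {a})" for a
  define K where "K M = (\<Sum>a\<in>#M. \<kappa> a)" for M
  define base where "base = \<Omega> - (W + E)"
  have \<kappa>: "\<kappa> a + ord a = \<Omega>" if "a \<in> L" for a
    unfolding \<kappa>_def \<Omega>_def using that finite_forms by (metis add.commute sum.remove)
  have exact: "exact_order n (K M) (\<tau> (cofactors M))" if "set_mset M \<subseteq> L" for M
    unfolding K_def cofactors_def deformation_prod_mset[OF \<tau>] cofactor_def deformation_prod[OF \<tau>] \<kappa>_def
    using that finite_forms ord(2)
    by (intro exact_order_prod_mset exact_order_prod n) auto
  have K_lower: "size M * base \<le> K M" if "set_mset M \<subseteq> L" for M
    using that
  proof (induction M)
    case (add a M)
    have "base \<le> \<kappa> a" using \<kappa>[of a] ord(1)[of a] add.prems by (simp add: base_def)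
    then show ?case using add by (simp add: K_def)
  qed (simp add: K_def)
  have K_upper: "K M \<le> size M * (base + E)" if "set_mset M \<subseteq> B" for M
    using that
  proof (induction M)
    case (add b M)
    have "\<kappa> b \<le> base + E"
      using \<kappa>[of b] ord(3)[of b] w(1)[of b] B(2) add.prems by (auto simp: base_def)
    then show ?case using add by (simp add: K_def)
  qed (simp add: K_def)
  have K_sum: "K M + (size M * W + (\<Sum>b\<in>#M. (d + 2) ^ e b)) = size M * \<Omega>" if "set_mset M \<subseteq> B" for M
    using that
  proof (induction M)
    case (add b M)
    have "\<kappa> b + (W + (d + 2) ^ e b) = \<Omega>"
      using \<kappa>[of b] ord(3)[of b] B(2) add.prems by (auto simp: w_def)
    then show ?case using add by (simp add: K_def)
  qed (simp add: K_def)
  have K_inj: "M1 = M2" if "M1 \<in> multisets_of_size B d" "M2 \<in> multisets_of_size B d" "K M1 = K M2" for M1 M2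
    using K_sum[of M1] K_sum[of M2] that
    by (intro sum_powers_determine_multiset[OF e fB, where q = "d + 2"]) (auto simp: multisets_of_size_def)
  define D where "D = W + d * base"
  \<comment> \<open>Multiplication by an element of \<open>n\<close> raises the order by \<open>W\<close>, hence
    beyond the order of every monomial of degree \<open>d\<close> in the cofactors of \<open>B\<close>.\<close>
  have K_less: "K M < D" if "M \<in> multisets_of_size B d" for M
    using K_upper[of M] that by (auto simp: D_def W_def multisets_of_size_def algebra_simps)
  have low_W: "vanishing_mod n W (\<tau> a)" if "a \<in> n" for a
    unfolding vanishing_mod_def
  proof (intro allI impI)
    fix i assume "i < W"
    then show "coeff (\<tau> a) i \<in> n"
      using \<tau> that ideal_zero[OF isn] by (cases "i = 0") (auto simp: deformation_def)
  qed
  have low_power: "vanishing_mod n (d * base) (\<tau> x)" if "x \<in> ideal_power cofactor_ideal d" for x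
  proof -
    have "cofactors ` multisets_of_size L d \<subseteq> {x. vanishing_mod n (d * base) (\<tau> x)}"
    proof clarify
      fix M assume "M \<in> multisets_of_size L d"
      then have M: "set_mset M \<subseteq> L" "size M = d" by (simp_all add: multisets_of_size_def)
      show "vanishing_mod n (d * base) (\<tau> (cofactors M))"
        using exact[OF M(1)] K_lower[OF M(1)] M(2) by (auto simp: exact_order_def intro: vanishing_mod_mono)
    qed
    then show ?thesis
      using that ideal_gen_minimal[OF _ vanishing_mod_deformation_ideal[OF n \<tau>]] unfolding cofactor_ideal_power by blast
  qed
  have "{a * x |a x. a \<in> n \<and> x \<in> ideal_power cofactor_ideal d} \<subseteq> {x. vanishing_mod n D (\<tau> x)}"
    using vanishing_mod_mult[OF isn low_W low_power] by (auto simp: \<tau>_mult D_def)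
  then have low_rel: "vanishing_mod n D (\<tau> (\<Sum>M\<in>multisets_of_size B d. c M * cofactors M))"
    using rel ideal_gen_minimal[OF _ vanishing_mod_deformation_ideal[OF n \<tau>]] by blast
  obtain M0 where M0: "M0 \<in> multisets_of_size B d" "c M0 \<notin> n"
    and min: "\<And>M. M \<in> multisets_of_size B d \<Longrightarrow> c M \<notin> n \<Longrightarrow> K M0 \<le> K M"
    using ex_has_least_nat[of "\<lambda>M. M \<in> multisets_of_size B d \<and> c M \<notin> n" M K] M cM by blast
  have sub: "set_mset M \<subseteq> L" "size M = d" if "M \<in> multisets_of_size B d" for M
    using that B(2) by (auto simp: multisets_of_size_def)
  have others: "coeff (\<tau> (c M * cofactors M)) (K M0) \<in> n" if M: "M \<in> multisets_of_size B d - {M0}" for M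
  proof (cases "c M \<in> n")
    case True
    have "vanishing_mod n (W + K M) (\<tau> (c M * cofactors M))"
      unfolding \<tau>_mult using exact[OF sub(1)] M by (intro vanishing_mod_mult isn low_W True) (auto simp: exact_order_def)
    moreover have "K M0 < W + K M"
      using K_less[OF M0(1)] K_lower[OF sub(1), of M] sub(2)[of M] M by (simp add: D_def)
    ultimately show ?thesis by (simp add: vanishing_mod_def)
  next
    case False
    have "vanishing_mod n (0 + K M) (\<tau> (c M * cofactors M))"
      unfolding \<tau>_mult using exact[OF sub(1)] M by (intro vanishing_mod_mult isn) (auto simp: exact_order_def vanishing_mod_def)
    moreover have "K M0 < K M"
      using min[of M] False M K_inj[OF M0(1), of M] by fastforce
    ultimately show ?thesis by (simp add: vanishing_mod_def)
  qed
  have "exact_order n 0 (\<tau> (c M0))"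
    using \<tau> M0 by (simp add: exact_order_def vanishing_mod_def deformation_def)
  from exact_order_mult[OF n this exact[OF sub(1)[OF M0(1)]]]
  have M0_coeff: "coeff (\<tau> (c M0 * cofactors M0)) (K M0) \<notin> n"
    by (simp add: \<tau>_mult exact_order_def)
  have "coeff (\<tau> (\<Sum>M\<in>multisets_of_size B d. c M * cofactors M)) (K M0)
        = coeff (\<tau> (c M0 * cofactors M0)) (K M0)
          + (\<Sum>M\<in>multisets_of_size B d - {M0}. coeff (\<tau> (c M * cofactors M)) (K M0))"
    unfolding deformation_sum[OF \<tau>] coeff_sum
    using M0 fB by (subst sum.remove[of _ M0]) auto
  moreover have "(\<Sum>M\<in>multisets_of_size B d - {M0}. coeff (\<tau> (c M * cofactors M)) (K M0)) \<in> n"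
    by (intro ideal_sum isn others)
  moreover have "coeff (\<tau> (\<Sum>M\<in>multisets_of_size B d. c M * cofactors M)) (K M0) \<in> n"
    using low_rel K_less[OF M0(1)] by (simp add: vanishing_mod_def)
  ultimately show False
    using M0_coeff ideal_diff_mem_iff[OF isn, of _ "coeff (\<tau> (c M0 * cofactors M0)) (K M0)"] by fastforce
qed


section \<open>Minimality of the polar ideal\<close>

lemma cofactor_power_mult:
  assumes "x \<in> ideal_power cofactor_ideal d" and "y \<in> ideal_power cofactor_ideal e"
  shows "x * y \<in> ideal_power cofactor_ideal (d + e)"
proof (rule ideal_gen_mult_set_minimal)
  show "x \<in> ideal_gen (cofactors ` multisets_of_size L d)"
    and "y \<in> ideal_gen (cofactors ` multisets_of_size L e)"
    using assms by (simp_all add: cofactor_ideal_power)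
  show "is_ideal (ideal_power cofactor_ideal (d + e))"
    by (simp add: cofactor_ideal_power is_ideal_ideal_gen)
  fix a b
  assume "a \<in> cofactors ` multisets_of_size L d" and "b \<in> cofactors ` multisets_of_size L e"
  then obtain M M' where "M \<in> multisets_of_size L d" "M' \<in> multisets_of_size L e" "a * b = cofactors (M + M')"
    by (auto simp: cofactors_def)
  then show "a * b \<in> ideal_power cofactor_ideal (d + e)"
    using cofactors_in_power[of "M + M'" "d + e"] by (auto simp: multisets_of_size_def)
qed

lemma cofactor_in_ideal: "a \<in> L \<Longrightarrow> cofactor a \<in> cofactor_ideal"
  unfolding cofactor_ideal_def by (intro ideal_gen_base imageI)

lemma cofactor_power_1: "cofactor_ideal \<subseteq> ideal_power cofactor_ideal 1"
  unfolding cofactor_ideal_power unfolding cofactor_ideal_def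
proof (rule ideal_gen_mono, clarify)
  fix a assume "a \<in> L"
  then show "cofactor a \<in> cofactors ` multisets_of_size L 1"
    by (intro image_eqI[of _ _ "{#a#}"]) (auto simp: multisets_of_size_def)
qed

lemma prod_mset_in_power: "set_mset Y \<subseteq> cofactor_ideal \<Longrightarrow> prod_mset Y \<in> ideal_power cofactor_ideal (size Y)"
proof (induction Y)
  case (add z Y)
  then have "z * prod_mset Y \<in> ideal_power cofactor_ideal (1 + size Y)"
    using cofactor_power_1 by (intro cofactor_power_mult) auto
  then show ?case by simp
qed simp

definition ideal_times_power :: "'a set \<Rightarrow> nat \<Rightarrow> 'a set"
  where "ideal_times_power n d = {a * x |a x. a \<in> n \<and> x \<in> ideal_power cofactor_ideal d}"

text \<open>Iterating $I^{r+1} \subseteq Z I^r + \mathfrak n I^{r+1}$ shows that $I^{r+k}$ is spanned modulo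
  $\mathfrak n I^{r+k}$ by products of \<open>k\<close> elements of \<open>Z\<close> with generators of $I^r$, so its dimension is
  bounded by a constant times the number of monomials of degree \<open>k\<close> in \<open>Z\<close>.\<close>

lemma cofactor_power_span_mod:
  assumes Z: "Z \<subseteq> cofactor_ideal"
    and step: "ideal_power cofactor_ideal (Suc r)
      \<subseteq> ideal_gen ({z * m |z m. z \<in> Z \<and> m \<in> cofactors ` multisets_of_size L r} \<union> ideal_times_power n (Suc r))"
  shows "ideal_power cofactor_ideal (r + k)
    \<subseteq> ideal_gen ((\<lambda>(Y, M). prod_mset Y * cofactors M) ` (multisets_of_size Z k \<times> multisets_of_size L r)
        \<union> ideal_times_power n (r + k))"
proof (induction k)
  case 0
  have "cofactors ` multisets_of_size L r
    \<subseteq> (\<lambda>(Y, M). prod_mset Y * cofactors M) ` (multisets_of_size Z 0 \<times> multisets_of_size L r)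
      \<union> ideal_times_power n (r + 0)"
    by force
  then show ?case
    unfolding cofactor_ideal_power[of "r + 0"] by (intro ideal_gen_mono) simp
next
  case (Suc k)
  let ?Q = "\<lambda>k. (\<lambda>(Y, M). prod_mset Y * cofactors M) ` (multisets_of_size Z k \<times> multisets_of_size L r)
        \<union> ideal_times_power n (r + k)"
  let ?I = "ideal_gen (?Q (Suc k))"
  have isI: "is_ideal ?I" by (rule is_ideal_ideal_gen)
  have times: "x * y \<in> ?I" if "y \<in> ideal_times_power n e" "x \<in> ideal_power cofactor_ideal e'" "e + e' = r + Suc k" for x y e e'
  proof -
    obtain a u where "y = a * u" "a \<in> n" "u \<in> ideal_power cofactor_ideal e"
      using \<open>y \<in> ideal_times_power n e\<close> by (auto simp: ideal_times_power_def)
    then have "x * y = a * (u * x)" "u * x \<in> ideal_power cofactor_ideal (r + Suc k)" "a \<in> n"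
      using cofactor_power_mult[of u e x e'] that by (simp_all add: ac_simps)
    then have "x * y \<in> ideal_times_power n (r + Suc k)" unfolding ideal_times_power_def by blast
    then show ?thesis by (intro ideal_gen_base) blast
  qed
  have "cofactor a * q \<in> ?I" if a: "a \<in> L" and q: "q \<in> ?Q k" for a q
    using q
  proof
    assume "q \<in> ideal_times_power n (r + k)"
    moreover have "cofactor a \<in> ideal_power cofactor_ideal 1"
      using cofactor_power_1 cofactor_in_ideal[OF a] by blast
    ultimately show ?thesis using times[of q "r + k" "cofactor a" 1] by simp
  next
    assume "q \<in> (\<lambda>(Y, M). prod_mset Y * cofactors M) ` (multisets_of_size Z k \<times> multisets_of_size L r)"
    then obtain Y M where Y: "Y \<in> multisets_of_size Z k" and M: "M \<in> multisets_of_size L r"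
      and q: "q = prod_mset Y * cofactors M" by auto
    have "cofactors (add_mset a M) \<in> ideal_power cofactor_ideal (Suc r)"
      using M a by (intro cofactors_in_power) (auto simp: multisets_of_size_def)
    then have "cofactors (add_mset a M)
      \<in> ideal_gen ({z * m |z m. z \<in> Z \<and> m \<in> cofactors ` multisets_of_size L r} \<union> ideal_times_power n (Suc r))"
      using step by blast
    then have "prod_mset Y * cofactors (add_mset a M) \<in> ?I"
    proof (induction rule: ideal_gen_induct)
      case (step c x y)
      have "prod_mset Y * x \<in> ?I"
        using step(1)
      proof
        assume "x \<in> ideal_times_power n (Suc r)"
        moreover have "prod_mset Y \<in> ideal_power cofactor_ideal k"
          using prod_mset_in_power[of Y] Z Y by (auto simp: multisets_of_size_def)
        ultimately show ?thesis using times[of x "Suc r" "prod_mset Y" k] by simp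
      next
        assume "x \<in> {z * m |z m. z \<in> Z \<and> m \<in> cofactors ` multisets_of_size L r}"
        then obtain z M' where z: "z \<in> Z" and M': "M' \<in> multisets_of_size L r" and x: "x = z * cofactors M'"
          by auto
        have "add_mset z Y \<in> multisets_of_size Z (Suc k)"
          using z Y by (auto simp: multisets_of_size_def)
        moreover have "prod_mset Y * x = prod_mset (add_mset z Y) * cofactors M'"
          by (simp add: x ac_simps)
        ultimately show ?thesis using M' by (intro ideal_gen_base) force
      qed
      from ideal_add[OF isI ideal_mult_left[OF isI this, of c] step(2)]
      show ?case by (simp add: algebra_simps)
    qed (simp add: ideal_gen_zero)
    then show ?thesis by (simp add: q ac_simps)
  qed
  note gen = this
  have "cofactor a * q \<in> ?I" if "a \<in> L" "q \<in> ideal_gen (?Q k)" for a q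
    using that(2)
  proof (induction rule: ideal_gen_induct)
    case (step c x y)
    from ideal_add[OF isI ideal_mult_left[OF isI gen[OF that(1) step(1)], of c] step(2)]
    show ?case by (simp add: algebra_simps)
  qed (simp add: ideal_gen_zero)
  moreover have "\<exists>a M'. M = add_mset a M' \<and> a \<in> L \<and> M' \<in> multisets_of_size L (r + k)"
    if "M \<in> multisets_of_size L (r + Suc k)" for M
  proof -
    have "size M = Suc (r + k)" using that by (simp add: multisets_of_size_def)
    from size_eq_Suc_imp_eq_union[OF this] obtain a M' where "M = add_mset a M'" by blast
    then show ?thesis using that by (auto simp: multisets_of_size_def)
  qed
  ultimately have "cofactors M \<in> ?I" if "M \<in> multisets_of_size L (r + Suc k)" for M
    using that Suc.IH cofactors_in_power by fastforce
  then show ?case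
    unfolding cofactor_ideal_power[of "r + Suc k"] by (intro ideal_gen_minimal isI) blast
qed


text \<open>The two counts of the dimension of $I^{r+k}/\mathfrak n I^{r+k}$ against each other.  That \<open>n\<close>
  contains at least one form is part of the argument: otherwise $f$ is a unit modulo \<open>n\<close>, while a power of $f$
  lies in \<open>K\<close> and so in \<open>n\<close>.  The functional $J/N \cong R/\mathfrak n$ is nonzero at some
  $\theta(\varphi_{b_0})$, and subtracting multiples of that element from the other
  $\theta(\varphi_b)$ gives the $|B| - 1$ generators \<open>Z\<close> of \<open>N\<close>.\<close>

theorem polar_ideal_minimal:
  assumes ne: "L \<noteq> {}"
    and deform: "\<And>B w W. independent B \<Longrightarrow> B \<subseteq> L \<Longrightarrow> 0 < W \<Longrightarrow> (\<And>b. b \<in> B \<Longrightarrow> W \<le> w b)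
      \<Longrightarrow> \<exists>\<tau>. deformation B w W \<tau>"
    and K: "is_ideal K" "K \<subseteq> polar_ideal"
    and red: "ideal_power cofactor_ideal (Suc r) \<subseteq> ideal_mult K (ideal_power cofactor_ideal r)"
  shows "K = polar_ideal"
proof (rule ccontr)
  assume "K \<noteq> polar_ideal"
  obtain G where G: "polar_ideal = ideal_gen G" "finite G" using polar_ideal_finite by metis
  let ?J = "polar_ideal" and ?I = cofactor_ideal
  obtain N y where N: "is_ideal N" "K \<subseteq> N" "N \<subseteq> ?J" and y: "y \<in> ?J" "y \<notin> N"
    and Ny: "\<And>x. x \<in> ?J \<Longrightarrow> \<exists>c. x - c * y \<in> N"
    and max: "maximal_ideal {a. \<forall>x\<in>?J. a * x \<in> N}"
    by (rule maximal_submodule[OF K \<open>K \<noteq> ?J\<close> G]) (rule that; assumption)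
  define n where "n = {a. \<forall>x\<in>?J. a * x \<in> N}"
  have n: "maximal_ideal n" using max by (simp add: n_def)
  have isn: "is_ideal n" using n by (rule maximal_ideal_is_ideal)
  have nJ: "a * x \<in> N" if "a \<in> n" "x \<in> ?J" for a x using that by (simp add: n_def)
  have JI: "?J \<subseteq> ?I" by (rule polar_ideal_subset)
  have KI: "ideal_mult K X \<subseteq> K" for X
    unfolding ideal_mult_def by (intro ideal_gen_minimal K) (auto intro: ideal_mult_right[OF K(1)])
  have neT: "L \<inter> n \<noteq> {}"
  proof
    assume "L \<inter> n = {}"
    then have f: "\<Prod>L \<notin> n" using maximal_ideal_prod_iff[OF n finite_forms] by blast
    have "\<Prod>L ^ k \<notin> n" for k
      by (induction k) (use n f in \<open>auto simp: maximal_ideal_mult_iff[OF n] maximal_ideal_def\<close>)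
    moreover have "\<Prod>L ^ Suc r \<in> n"
    proof -
      have "\<Prod>L \<in> ?I" using defining_in_polar_ideal[OF ne] JI by blast
      then have "prod_mset (replicate_mset (Suc r) (\<Prod>L)) \<in> ideal_power ?I (Suc r)"
        using prod_mset_in_power[of "replicate_mset (Suc r) (\<Prod>L)"] by (metis empty_subsetI insert_subset set_mset_replicate_mset_subset size_replicate_mset)
      then have "\<Prod>L ^ Suc r \<in> N" using red KI N(2) by (auto simp del: ideal_power.simps)
      then show ?thesis unfolding n_def using ideal_mult_right[OF N(1)] by blast
    qed
    ultimately show False by blast
  qed
  obtain B where B: "B \<subseteq> L \<inter> n" "independent B" "L \<inter> n \<subseteq> span B"
    using maximal_independent_subset by blast
  have BL: "B \<subseteq> L" using B by blast
  have fB: "finite B" using BL finite_forms finite_subset by blast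
  define \<theta> where "\<theta> b = polar UNIV (coord B b)" for b
  have \<theta>J: "\<theta> b \<in> ?J" for b
    unfolding \<theta>_def by (intro polar_in_ideal functional_coord B)
  obtain b0 where b0: "b0 \<in> B" "\<theta> b0 \<notin> N"
    using polar_ideal_local_generators[OF n N(1) nJ B(2,1,3) neT] y unfolding \<theta>_def by blast
  have "\<exists>c. \<theta> b - c * \<theta> b0 \<in> N" for b
  proof -
    obtain c c0 where c: "\<theta> b - c * y \<in> N" "\<theta> b0 - c0 * y \<in> N" using Ny \<theta>J by meson
    have "c0 \<notin> n" using nJ[of c0 y] y(1) b0(2) ideal_add[OF N(1) c(2), of "c0 * y"] by auto
    then obtain u where u: "u * c0 - 1 \<in> n" using n by (auto simp: maximal_ideal_def)
    have "\<theta> b - (c * u) * \<theta> b0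
          = (\<theta> b - c * y) - (c * u) * (\<theta> b0 - c0 * y) - c * ((u * c0 - 1) * y)"
      by (simp add: algebra_simps)
    also have "\<dots> \<in> N"
      by (rule ideal_diff[OF N(1) ideal_diff[OF N(1) c(1) ideal_mult_left[OF N(1) c(2)]]
            ideal_mult_left[OF N(1) nJ[OF u y(1)]]])
    finally show ?thesis by blast
  qed
  then obtain c where c: "\<And>b. \<theta> b - c b * \<theta> b0 \<in> N" by metis
  let ?A = "B - {b0}"
  define Z where "Z = (\<lambda>b. \<theta> b - c b * \<theta> b0) ` ?A"
  define nJs where "nJs = {a * x |a x. a \<in> n \<and> x \<in> ?J}"
  have ZN: "Z \<subseteq> N" using c by (auto simp: Z_def)
  have nJsN: "nJs \<subseteq> N" using nJ by (auto simp: nJs_def)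
  let ?Q = "ideal_gen (Z \<union> nJs)"
  have QN: "?Q \<subseteq> N" using ZN nJsN by (intro ideal_gen_minimal N(1)) blast
  have "\<theta> b \<in> ideal_gen (insert (\<theta> b0) (Z \<union> nJs))" if b: "b \<in> B" for b
  proof (cases "b = b0")
    case False
    then have "\<theta> b - c b * \<theta> b0 \<in> ideal_gen (Z \<union> nJs)"
      using b by (intro ideal_gen_base) (auto simp: Z_def)
    then show ?thesis by (auto simp: ideal_gen_insert)
  qed (auto intro: ideal_gen_base)
  then have J_gen: "?J \<subseteq> ideal_gen (insert (\<theta> b0) (Z \<union> nJs))"
    unfolding \<theta>_def
    by (intro polar_ideal_local_generators[OF n is_ideal_ideal_gen _ B(2,1,3) neT])
      (auto simp: nJs_def intro!: ideal_gen_base)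
  have NQ: "N \<subseteq> ?Q"
  proof
    fix x assume x: "x \<in> N"
    then have "x \<in> ideal_gen (insert (\<theta> b0) (Z \<union> nJs))" using J_gen N(3) by blast
    then obtain k where k: "x - k * \<theta> b0 \<in> ?Q" using ideal_gen_insert by blast
    have "k * \<theta> b0 \<in> N" using ideal_diff[OF N(1) x subsetD[OF QN k]] by simp
    then have "k \<in> n" using maximal_ideal_unit_cancel[OF n _ _ N(1) nJ, of k "\<theta> b0"] b0(2) \<theta>J by blast
    then have "k * \<theta> b0 \<in> ?Q" using \<theta>J by (intro ideal_gen_base) (auto simp: nJs_def)
    from ideal_gen_add[OF k this] show "x \<in> ?Q" by simp
  qed
  have step: "ideal_power ?I (Suc r)
      \<subseteq> ideal_gen ({z * m |z m. z \<in> Z \<and> m \<in> cofactors ` multisets_of_size L r} \<union> ideal_times_power n (Suc r))"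
    (is "_ \<subseteq> ?R")
  proof -
    have "z * m \<in> ?R" if z: "z \<in> Z \<union> nJs" and m: "m \<in> cofactors ` multisets_of_size L r" for z m
      using z
    proof
      assume "z \<in> Z"
      then show ?thesis using m by (intro ideal_gen_base) blast
    next
      assume "z \<in> nJs"
      then obtain a x where ax: "z = a * x" "a \<in> n" "x \<in> ?J" by (auto simp: nJs_def)
      have "m \<in> ideal_power ?I r" using m cofactors_in_power by blast
      then have "x * m \<in> ideal_power ?I (1 + r)"
        using ax JI cofactor_power_1 by (intro cofactor_power_mult) blast+
      then have "z * m \<in> ideal_times_power n (Suc r)"
        unfolding ideal_times_power_def using ax by (auto simp: mult.assoc simp del: ideal_power.simps)
      then show ?thesis by (intro ideal_gen_base) blast
    qed
    from ideal_gen_mult_set_minimal[OF this is_ideal_ideal_gen]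
    have "x * m \<in> ?R" if "x \<in> K" "m \<in> ideal_power ?I r" for x m
      using that N(2) NQ unfolding cofactor_ideal_power by blast
    then have "ideal_mult K (ideal_power ?I r) \<subseteq> ?R"
      unfolding ideal_mult_def by (intro ideal_gen_minimal is_ideal_ideal_gen) blast
    then show ?thesis using red by blast
  qed
  have ZI: "Z \<subseteq> ?I" using ZN N(3) JI by blast
  note span_mod = cofactor_power_span_mod[OF ZI step]
  have fA: "finite ?A" "finite Z" using fB by (auto simp: Z_def)
  obtain k where k: "card (multisets_of_size L r) * card (multisets_of_size ?A k)
      < card (multisets_of_size (insert b0 ?A) (r + k))"
    using multisets_outgrow_one_element_fewer[OF fA(1), of b0 "card (multisets_of_size L r)" r] by blast
  define Y where "Y = (\<lambda>(Y, M). prod_mset Y * cofactors M) ` (multisets_of_size Z k \<times> multisets_of_size L r)"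
  define P where "P = ideal_gen (ideal_times_power n (r + k))"
  have fY: "finite Y" unfolding Y_def using fA finite_forms by blast
  have "card Y \<le> card (multisets_of_size Z k) * card (multisets_of_size L r)"
    unfolding Y_def using fA finite_forms
    by (metis card_cartesian_product card_image_le finite_cartesian_product finite_multisets_of_size)
  also have "card (multisets_of_size Z k) \<le> card (multisets_of_size ?A k)"
    unfolding card_multisets_of_size[OF fA(1)] card_multisets_of_size[OF fA(2)]
    using card_image_le[OF fA(1), of "\<lambda>b. \<theta> b - c b * \<theta> b0"]
    by (intro binomial_right_mono diff_le_mono add_right_mono) (simp only: Z_def)
  finally have cardY: "card Y < card (multisets_of_size B (r + k))"
    using k b0 by (simp add: insert_absorb mult.commute)
  have YI: "Y \<subseteq> ideal_power ?I (r + k)"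
  proof -
    have "prod_mset X * cofactors M \<in> ideal_power ?I (k + r)"
      if "X \<in> multisets_of_size Z k" "M \<in> multisets_of_size L r" for X M
      using prod_mset_in_power[of X] that ZI
      by (intro cofactor_power_mult cofactors_in_power) (auto simp: multisets_of_size_def)
    then show ?thesis by (auto simp: Y_def add.commute)
  qed
  have "\<exists>c. (\<exists>M\<in>multisets_of_size B (r + k). c M \<notin> n)
      \<and> (\<Sum>M\<in>multisets_of_size B (r + k). c M * cofactors M) \<in> P"
  proof (rule dependent_mod_maximal_ideal[OF n _ fY _ cardY])
    show "is_ideal P" by (simp add: P_def is_ideal_ideal_gen)
    show "finite (multisets_of_size B (r + k))" using fB by blast
    show "a * z \<in> P" if "a \<in> n" "z \<in> Y" for a z
      unfolding P_def ideal_times_power_def using that YI by (intro ideal_gen_base) blast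
    show "cofactors M \<in> ideal_gen (Y \<union> P)" if "M \<in> multisets_of_size B (r + k)" for M
    proof -
      have "cofactors M \<in> ideal_power ?I (r + k)"
        using that BL by (intro cofactors_in_power) (auto simp: multisets_of_size_def)
      moreover have "ideal_gen (Y \<union> ideal_times_power n (r + k)) \<subseteq> ideal_gen (Y \<union> P)"
        by (intro ideal_gen_mono) (auto simp: P_def intro: ideal_gen_base)
      ultimately show ?thesis using span_mod[of k] unfolding Y_def by blast
    qed
  qed
  then show False
    using cofactors_independent_mod[OF n B(2,1,3) deform[OF B(2) BL]]
    unfolding P_def ideal_times_power_def by blast
qed

end


section \<open>Polynomials as sums of monomials\<close>

lemma lookup_mpoly_scale [simp]: "Poly_Mapping.lookup (mpoly_scale c p) a = c * Poly_Mapping.lookup p a"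
  unfolding mpoly_scale_def mult_map_scale_conv_mult[symmetric]
  by transfer (simp add: when_def)

lemma mpoly_sum_singles:
  assumes "finite S" and "Poly_Mapping.keys p \<subseteq> S"
  shows "p = (\<Sum>a\<in>S. Poly_Mapping.single a (Poly_Mapping.lookup p a))"
proof (rule poly_mapping_eqI)
  fix b
  have "Poly_Mapping.lookup (\<Sum>a\<in>S. Poly_Mapping.single a (Poly_Mapping.lookup p a)) b = (\<Sum>a\<in>S. if a = b then Poly_Mapping.lookup p b else 0)"
    by (auto simp: lookup_sum lookup_single when_def intro!: sum.cong)
  also have "\<dots> = Poly_Mapping.lookup p b"
    using assms by (auto simp: in_keys_iff)
  finally show "Poly_Mapping.lookup p b = Poly_Mapping.lookup (\<Sum>a\<in>S. Poly_Mapping.single a (Poly_Mapping.lookup p a)) b" by simp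
qed

text \<open>Multiplication by a monomial shifts coefficients.\<close>

lemma lookup_single_mult:
  fixes q :: "('n, 'k::comm_ring_1) mpoly"
  shows "Poly_Mapping.lookup (Poly_Mapping.single a c * q) (a + b) = c * Poly_Mapping.lookup q b"
    and "(\<And>b. k \<noteq> a + b) \<Longrightarrow> Poly_Mapping.lookup (Poly_Mapping.single a c * q) k = 0"
proof -
  have q: "Poly_Mapping.single a c * q = (\<Sum>b\<in>Poly_Mapping.keys q. Poly_Mapping.single (a + b) (c * Poly_Mapping.lookup q b))"
    by (subst mpoly_sum_singles[of "Poly_Mapping.keys q" q]) (auto simp: sum_distrib_left mult_single)
  have "Poly_Mapping.lookup (Poly_Mapping.single a c * q) (a + b)
        = (\<Sum>b'\<in>Poly_Mapping.keys q. if b' = b then c * Poly_Mapping.lookup q b else 0)"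
    unfolding q lookup_sum by (intro sum.cong) (auto simp: lookup_single when_def)
  then show "Poly_Mapping.lookup (Poly_Mapping.single a c * q) (a + b) = c * Poly_Mapping.lookup q b"
    by (auto simp: in_keys_iff)
  show "Poly_Mapping.lookup (Poly_Mapping.single a c * q) k = 0" if "\<And>b. k \<noteq> a + b"
    unfolding q lookup_sum using that by (intro sum.neutral) (auto simp: lookup_single when_def)
qed

abbreviation var :: "'n \<Rightarrow> ('n, 'k::comm_ring_1) mpoly"
  where "var i \<equiv> Poly_Mapping.single (Poly_Mapping.single i 1) 1"

abbreviation lin_coeff :: "('n, 'k::comm_ring_1) mpoly \<Rightarrow> 'n \<Rightarrow> 'k"
  where "lin_coeff p i \<equiv> Poly_Mapping.lookup p (Poly_Mapping.single i 1)"

lemma mpoly_scale_var: "mpoly_scale c (var i) = Poly_Mapping.single (Poly_Mapping.single i 1) c"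
  by (simp add: mpoly_scale_def mult_single)

lemma linear_form_sum_vars:
  fixes p :: "('n::finite, 'k::comm_ring_1) mpoly"
  assumes "p \<in> linear_forms"
  shows "p = (\<Sum>i\<in>UNIV. mpoly_scale (lin_coeff p i) (var i))"
proof -
  have "a \<in> range (\<lambda>i. Poly_Mapping.single i 1)" if "a \<in> Poly_Mapping.keys p" for a
  proof -
    have one: "(\<Sum>i\<in>UNIV. Poly_Mapping.lookup a i) = 1" using assms that by (simp add: linear_forms_def)
    then obtain i where i: "Poly_Mapping.lookup a i \<noteq> 0" by fastforce
    have split: "(\<Sum>i\<in>UNIV. Poly_Mapping.lookup a i) = Poly_Mapping.lookup a i + (\<Sum>j\<in>UNIV - {i}. Poly_Mapping.lookup a j)"
      by (simp add: sum.remove)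
    have "Poly_Mapping.lookup a j = 0" if "j \<noteq> i" for j
    proof -
      have "(\<Sum>j\<in>UNIV - {i}. Poly_Mapping.lookup a j) = 0" using one i split by linarith
      then show ?thesis using that by simp
    qed
    moreover have "Poly_Mapping.lookup a i = 1" using one i split by linarith
    ultimately have "a = Poly_Mapping.single i 1"
      by (intro poly_mapping_eqI) (auto simp: lookup_single when_def)
    then show ?thesis by blast
  qed
  then have "Poly_Mapping.keys p \<subseteq> range (\<lambda>i. Poly_Mapping.single i 1)" by blast
  from mpoly_sum_singles[OF _ this]
  have "p = (\<Sum>a\<in>range (\<lambda>i. Poly_Mapping.single i 1). Poly_Mapping.single a (Poly_Mapping.lookup p a))" by simp
  also have "\<dots> = (\<Sum>i\<in>UNIV. mpoly_scale (lin_coeff p i) (var i))"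
    unfolding mpoly_scale_var by (subst sum.reindex) (auto intro!: injI dest: arg_cong[where f = Poly_Mapping.keys])
  finally show ?thesis .
qed

text \<open>The type of variables carries no order, so leading terms are taken with respect to a single variable that
  occurs in the form.\<close>

lemma linear_form_cancel:
  fixes p q :: "('n::finite, 'k::field) mpoly"
  assumes p: "p \<in> linear_forms" "p \<noteq> 0" and pq: "p * q = 0"
  shows "q = 0"
proof (rule ccontr)
  assume "q \<noteq> 0"
  then have ne: "Poly_Mapping.keys q \<noteq> {}" by (metis lookup_zero not_in_keys_iff_lookup_eq_zero poly_mapping_eqI empty_iff)
  obtain j where j: "lin_coeff p j \<noteq> 0"
  proof (rule ccontr)
    assume "\<not> thesis"
    then have "\<And>i. lin_coeff p i = 0" using that by blast
    then show False using linear_form_sum_vars[OF p(1)] p(2) by (simp add: mpoly_scale_def)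
  qed
  \<comment> \<open>A monomial of \<open>q\<close> of maximal degree in \<open>x\<^sub>j\<close>, times \<open>x\<^sub>j\<close>, cannot be cancelled.\<close>
  define b where "b = (ARG_MAX (\<lambda>a. Poly_Mapping.lookup a j) a. a \<in> Poly_Mapping.keys q)"
  have b: "b \<in> Poly_Mapping.keys q" "\<And>a. a \<in> Poly_Mapping.keys q \<Longrightarrow> Poly_Mapping.lookup a j \<le> Poly_Mapping.lookup b j"
  proof -
    obtain a where a: "a \<in> Poly_Mapping.keys q" using ne by blast
    obtain N where N: "\<forall>a\<in>Poly_Mapping.keys q. Poly_Mapping.lookup a j \<le> N"
      using finite_nat_set_iff_bounded_le[of "(\<lambda>a. Poly_Mapping.lookup a j) ` Poly_Mapping.keys q"] by auto
    from arg_max_nat_lemma[of "\<lambda>a. a \<in> Poly_Mapping.keys q" a "\<lambda>a. Poly_Mapping.lookup a j" "Suc N"] a N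
    show "b \<in> Poly_Mapping.keys q" "\<And>a. a \<in> Poly_Mapping.keys q \<Longrightarrow> Poly_Mapping.lookup a j \<le> Poly_Mapping.lookup b j"
      unfolding b_def by (auto simp: less_Suc_eq_le)
  qed
  let ?k = "Poly_Mapping.single j 1 + b"
  have "Poly_Mapping.lookup (p * q) ?k = (\<Sum>i\<in>UNIV. Poly_Mapping.lookup (Poly_Mapping.single (Poly_Mapping.single i 1) (lin_coeff p i) * q) ?k)"
    by (subst linear_form_sum_vars[OF p(1)]) (simp add: mpoly_scale_var sum_distrib_right lookup_sum del: One_nat_def)
  also have "\<dots> = (\<Sum>i\<in>UNIV. if i = j then lin_coeff p j * Poly_Mapping.lookup q b else 0)"
  proof (intro sum.cong refl)
    fix i :: 'n
    show "Poly_Mapping.lookup (Poly_Mapping.single (Poly_Mapping.single i 1) (lin_coeff p i) * q) ?k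
          = (if i = j then lin_coeff p j * Poly_Mapping.lookup q b else 0)"
    proof (cases "i = j")
      case True
      then show ?thesis unfolding True lookup_single_mult(1) by simp
    next
      case False
      show ?thesis
      proof (cases "\<exists>b'. ?k = Poly_Mapping.single i 1 + b'")
        case True
        then obtain b' where b': "?k = Poly_Mapping.single i 1 + b'" by blast
        from arg_cong[OF this, of "\<lambda>a. Poly_Mapping.lookup a j"] False
        have "Poly_Mapping.lookup b' j = Suc (Poly_Mapping.lookup b j)" by (simp add: lookup_add lookup_single when_def)
        then have "Poly_Mapping.lookup q b' = 0" using b(2)[of b'] by (auto simp: in_keys_iff)
        then show ?thesis unfolding b' lookup_single_mult(1) using False by simp
      next
        case no: False
        then show ?thesis using lookup_single_mult(2)[of ?k "Poly_Mapping.single i 1"] False by simp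
      qed
    qed
  qed
  also have "\<dots> = lin_coeff p j * Poly_Mapping.lookup q b" by simp
  finally show False using j b(1) pq by (simp add: in_keys_iff)
qed

section \<open>Partial derivatives\<close>

lemma partial_deriv_sum_superset:
  assumes "finite S" and "Poly_Mapping.keys p \<subseteq> S"
  shows "partial_deriv i p = (\<Sum>a\<in>S. Poly_Mapping.single (a - Poly_Mapping.single i 1)
           (of_nat (Poly_Mapping.lookup a i) * Poly_Mapping.lookup p a))"
  unfolding partial_deriv_def
  using assms by (intro sum.mono_neutral_left) (auto simp: in_keys_iff)

lemma partial_deriv_add: "partial_deriv i (p + q) = partial_deriv i p + partial_deriv i q"
proof -
  let ?S = "Poly_Mapping.keys p \<union> Poly_Mapping.keys q"
  have S: "finite ?S" by simp
  show ?thesis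
    using partial_deriv_sum_superset[OF S, of p i] partial_deriv_sum_superset[OF S, of q i]
      partial_deriv_sum_superset[OF S, of "p + q" i] keys_add[of p q]
    by (simp add: lookup_add distrib_left single_add sum.distrib)
qed

lemma partial_deriv_0 [simp]: "partial_deriv i 0 = 0"
  by (simp add: partial_deriv_def)

lemma partial_deriv_sum: "partial_deriv i (\<Sum>x\<in>A. g x) = (\<Sum>x\<in>A. partial_deriv i (g x))"
  by (induction A rule: infinite_finite_induct) (simp_all add: partial_deriv_add)

lemma partial_deriv_single:
  "partial_deriv i (Poly_Mapping.single a c)
   = Poly_Mapping.single (a - Poly_Mapping.single i 1) (of_nat (Poly_Mapping.lookup a i) * c)"
  using partial_deriv_sum_superset[of "{a}" "Poly_Mapping.single a c" i] by simp

lemma diff_single_add: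
  fixes a b :: "'n \<Rightarrow>\<^sub>0 nat"
  assumes "Poly_Mapping.lookup a i \<noteq> 0"
  shows "(a - Poly_Mapping.single i 1) + b = a + b - Poly_Mapping.single i 1"
  using assms by (intro poly_mapping_eqI) (auto simp: lookup_add lookup_minus lookup_single when_def)

lemma partial_deriv_mult_single:
  "partial_deriv i (Poly_Mapping.single a c * Poly_Mapping.single b d)
   = partial_deriv i (Poly_Mapping.single a c) * Poly_Mapping.single b d
     + Poly_Mapping.single a c * partial_deriv i (Poly_Mapping.single b d)"
proof -
  let ?e = "Poly_Mapping.single i (1::nat)"
  have 1: "Poly_Mapping.single (a - ?e + b) (of_nat (Poly_Mapping.lookup a i) * c * d)
        = Poly_Mapping.single (a + b - ?e) (of_nat (Poly_Mapping.lookup a i) * c * d)"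
    by (cases "Poly_Mapping.lookup a i = 0") (simp_all add: diff_single_add del: One_nat_def)
  have 2: "Poly_Mapping.single (a + (b - ?e)) (of_nat (Poly_Mapping.lookup b i) * d * c)
        = Poly_Mapping.single (a + b - ?e) (of_nat (Poly_Mapping.lookup b i) * d * c)"
    using diff_single_add[of b i a] by (cases "Poly_Mapping.lookup b i = 0") (simp_all add: add.commute del: One_nat_def)
  show ?thesis
    using 1 2 by (simp add: partial_deriv_single mult_single lookup_add distrib_left single_add ac_simps)
qed

lemma partial_deriv_mult:
  "partial_deriv i (p * q) = partial_deriv i p * q + p * partial_deriv i q"
proof -
  let ?P = "Poly_Mapping.keys p" and ?Q = "Poly_Mapping.keys q"
  let ?s = "\<lambda>p a. Poly_Mapping.single a (Poly_Mapping.lookup p a)"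
  have p: "p = (\<Sum>a\<in>?P. ?s p a)" and q: "q = (\<Sum>b\<in>?Q. ?s q b)"
    by (intro mpoly_sum_singles; simp)+
  have "partial_deriv i ((\<Sum>a\<in>?P. ?s p a) * (\<Sum>b\<in>?Q. ?s q b))
      = (\<Sum>a\<in>?P. \<Sum>b\<in>?Q. partial_deriv i (?s p a) * ?s q b + ?s p a * partial_deriv i (?s q b))"
    by (simp add: sum_product partial_deriv_sum partial_deriv_mult_single)
  also have "\<dots> = partial_deriv i (\<Sum>a\<in>?P. ?s p a) * (\<Sum>b\<in>?Q. ?s q b)
      + (\<Sum>a\<in>?P. ?s p a) * partial_deriv i (\<Sum>b\<in>?Q. ?s q b)"
    by (simp add: sum_product partial_deriv_sum sum.distrib)
  finally show ?thesis unfolding p[symmetric] q[symmetric] .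
qed

lemma partial_deriv_prod:
  assumes "finite A"
  shows "partial_deriv i (\<Prod>A) = (\<Sum>a\<in>A. partial_deriv i a * \<Prod>(A - {a}))"
  using assms
proof (induction A)
  case empty
  show ?case by (simp add: partial_deriv_single flip: single_one)
next
  case (insert x A)
  have "(\<Sum>a\<in>A. partial_deriv i a * \<Prod>(insert x A - {a})) = x * (\<Sum>a\<in>A. partial_deriv i a * \<Prod>(A - {a}))"
    unfolding sum_distrib_left
  proof (intro sum.cong refl)
    fix a assume "a \<in> A"
    then have "insert x A - {a} = insert x (A - {a})" using insert by auto
    then show "partial_deriv i a * \<Prod>(insert x A - {a}) = x * (partial_deriv i a * \<Prod>(A - {a}))"
      using insert by (simp add: ac_simps)
  qed
  then show ?case using insert by (simp add: partial_deriv_mult)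
qed

lemma partial_deriv_linear_form:
  fixes p :: "('n::finite, 'k::comm_ring_1) mpoly"
  assumes "p \<in> linear_forms"
  shows "partial_deriv i p = Poly_Mapping.single 0 (lin_coeff p i)"
proof -
  have "partial_deriv i p = (\<Sum>j\<in>UNIV. partial_deriv i (mpoly_scale (lin_coeff p j) (var j)))"
    by (subst (1) linear_form_sum_vars[OF assms]) (simp add: partial_deriv_sum)
  also have "\<dots> = (\<Sum>j\<in>UNIV. if j = i then Poly_Mapping.single 0 (lin_coeff p i) else 0)"
    by (intro sum.cong) (auto simp: mpoly_scale_var partial_deriv_single lookup_single when_def simp del: One_nat_def)
  finally show ?thesis by simp
qed

section \<open>Substitution\<close>

text \<open>Evaluation at a point of another ring \<open>'r\<close>, with coefficients mapped by \<open>\<gamma>\<close>.\<close>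

definition mpoly_subst :: "('k::comm_ring_1 \<Rightarrow> 'r::comm_ring_1) \<Rightarrow> ('n::finite \<Rightarrow> 'r) \<Rightarrow> ('n, 'k) mpoly \<Rightarrow> 'r"
  where "mpoly_subst \<gamma> z p = (\<Sum>a\<in>Poly_Mapping.keys p. \<gamma> (Poly_Mapping.lookup p a) * (\<Prod>i\<in>UNIV. z i ^ Poly_Mapping.lookup a i))"

locale coefficient_hom =
  fixes \<gamma> :: "'k::comm_ring_1 \<Rightarrow> 'r::comm_ring_1" and z :: "'n::finite \<Rightarrow> 'r"
  assumes hom_0: "\<gamma> 0 = 0" and hom_1: "\<gamma> 1 = 1"
    and hom_add: "\<gamma> (c + d) = \<gamma> c + \<gamma> d" and hom_mult: "\<gamma> (c * d) = \<gamma> c * \<gamma> d"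
begin

lemma subst_superset:
  assumes "finite S" and "Poly_Mapping.keys p \<subseteq> S"
  shows "mpoly_subst \<gamma> z p = (\<Sum>a\<in>S. \<gamma> (Poly_Mapping.lookup p a) * (\<Prod>i\<in>UNIV. z i ^ Poly_Mapping.lookup a i))"
  unfolding mpoly_subst_def
  using assms by (intro sum.mono_neutral_left) (auto simp: in_keys_iff hom_0)

lemma subst_add: "mpoly_subst \<gamma> z (p + q) = mpoly_subst \<gamma> z p + mpoly_subst \<gamma> z q"
proof -
  let ?S = "Poly_Mapping.keys p \<union> Poly_Mapping.keys q"
  have S: "finite ?S" by simp
  show ?thesis
    using subst_superset[OF S, of p] subst_superset[OF S, of q] subst_superset[OF S, of "p + q"] keys_add[of p q]
    by (simp add: lookup_add hom_add distrib_right sum.distrib)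
qed

lemma subst_0: "mpoly_subst \<gamma> z 0 = 0"
  by (simp add: mpoly_subst_def)

lemma subst_sum: "mpoly_subst \<gamma> z (\<Sum>x\<in>A. g x) = (\<Sum>x\<in>A. mpoly_subst \<gamma> z (g x))"
  by (induction A rule: infinite_finite_induct) (simp_all add: subst_add subst_0)

lemma subst_single:
  "mpoly_subst \<gamma> z (Poly_Mapping.single a c) = \<gamma> c * (\<Prod>i\<in>UNIV. z i ^ Poly_Mapping.lookup a i)"
  using subst_superset[of "{a}" "Poly_Mapping.single a c"] by simp

lemma subst_mult: "mpoly_subst \<gamma> z (p * q) = mpoly_subst \<gamma> z p * mpoly_subst \<gamma> z q"
proof -
  let ?P = "Poly_Mapping.keys p" and ?Q = "Poly_Mapping.keys q"
  let ?s = "\<lambda>p a. Poly_Mapping.single a (Poly_Mapping.lookup p a)"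
  have p: "p = (\<Sum>a\<in>?P. ?s p a)" and q: "q = (\<Sum>b\<in>?Q. ?s q b)"
    by (intro mpoly_sum_singles; simp)+
  have "mpoly_subst \<gamma> z ((\<Sum>a\<in>?P. ?s p a) * (\<Sum>b\<in>?Q. ?s q b))
      = mpoly_subst \<gamma> z (\<Sum>a\<in>?P. ?s p a) * mpoly_subst \<gamma> z (\<Sum>b\<in>?Q. ?s q b)"
    by (simp add: sum_product subst_sum mult_single subst_single hom_mult lookup_add power_add prod.distrib ac_simps)
  then show ?thesis unfolding p[symmetric] q[symmetric] .
qed

lemma subst_const: "mpoly_subst \<gamma> z (Poly_Mapping.single 0 c) = \<gamma> c"
  by (simp add: subst_single)

lemma subst_1: "mpoly_subst \<gamma> z 1 = 1"
  using subst_const[of 1] by (simp add: hom_1)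

lemma subst_var: "mpoly_subst \<gamma> z (var i) = z i"
proof -
  have "(\<Prod>j\<in>UNIV. z j ^ Poly_Mapping.lookup (Poly_Mapping.single i 1) j) = (\<Prod>j\<in>UNIV. if j = i then z i else 1)"
    by (intro prod.cong) (auto simp: lookup_single when_def)
  then show ?thesis by (simp add: subst_single hom_1)
qed

lemma subst_scale: "mpoly_subst \<gamma> z (mpoly_scale c p) = \<gamma> c * mpoly_subst \<gamma> z p"
  by (simp add: mpoly_scale_def subst_mult subst_const)

end

lemma mpoly_subst_cong_mod:
  assumes "coefficient_hom \<gamma>" and "\<And>i. t dvd z i - z' i"
  shows "t dvd mpoly_subst \<gamma> z p - mpoly_subst \<gamma> z' p"
proof -
  have mult: "t dvd a * b - a' * b'" if "t dvd a - a'" "t dvd b - b'" for a b a' b' :: 'b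
  proof -
    have "a * b - a' * b' = (a - a') * b + a' * (b - b')" by (simp add: algebra_simps)
    then show ?thesis using that by simp
  qed
  have pow: "t dvd z i ^ k - z' i ^ k" for i k
    by (induction k) (use assms(2) mult in auto)
  have "t dvd (\<Prod>i\<in>S. z i ^ Poly_Mapping.lookup a i) - (\<Prod>i\<in>S. z' i ^ Poly_Mapping.lookup a i)" for S a
    by (induction S rule: infinite_finite_induct) (use mult pow in auto)
  then show ?thesis
    unfolding mpoly_subst_def sum_subtractf[symmetric] right_diff_distrib[symmetric]
    by (intro dvd_sum dvd_mult)
qed

lemma mpoly_subst_self:
  fixes p :: "('n::finite, 'k::comm_ring_1) mpoly"
  shows "mpoly_subst (\<lambda>c. [:Poly_Mapping.single 0 c:]) (\<lambda>i. [:var i:]) p = [:p:]"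
proof -
  have pow: "(\<Prod>i\<in>S. [:var i :: ('n, 'k) mpoly:] ^ Poly_Mapping.lookup a i)
      = [:Poly_Mapping.single (\<Sum>i\<in>S. Poly_Mapping.single i (Poly_Mapping.lookup a i)) 1:]" for a S
  proof (induction S rule: infinite_finite_induct)
    case (insert i S)
    have "[:var i :: ('n, 'k) mpoly:] ^ k = [:Poly_Mapping.single (Poly_Mapping.single i k) 1:]" for k
      by (induction k) (simp_all add: mult_single flip: single_add)
    then show ?case using insert by (simp add: mult_single add.commute)
  qed simp_all
  have a: "(\<Sum>i\<in>UNIV. Poly_Mapping.single i (Poly_Mapping.lookup a i)) = a" for a :: "'n \<Rightarrow>\<^sub>0 nat"
    using mpoly_sum_singles[of UNIV a] by simp
  have "mpoly_subst (\<lambda>c. [:Poly_Mapping.single 0 c:]) (\<lambda>i. [:var i:]) p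
      = (\<Sum>a\<in>Poly_Mapping.keys p. [:Poly_Mapping.single a (Poly_Mapping.lookup p a):])"
    unfolding mpoly_subst_def pow a by (simp add: mult_single)
  also have "\<dots> = [:\<Sum>a\<in>Poly_Mapping.keys p. Poly_Mapping.single a (Poly_Mapping.lookup p a):]"
    by (induction "Poly_Mapping.keys p" rule: infinite_finite_induct)
      (auto simp: sum_to_poly)
  also have "\<dots> = [:p:]" using mpoly_sum_singles[of "Poly_Mapping.keys p" p] by simp
  finally show ?thesis .
qed


section \<open>Forms of an arrangement\<close>

lemma form_family_linear_forms:
  fixes L :: "('n::finite, 'k::field_char_0) mpoly set"
  assumes "finite L" and "\<And>a. a \<in> L \<Longrightarrow> a \<in> linear_forms \<and> a \<noteq> 0"
  shows "form_family mpoly_scale L"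
proof -
  interpret vector_space "mpoly_scale :: 'k \<Rightarrow> ('n, 'k) mpoly \<Rightarrow> ('n, 'k) mpoly"
    by (rule vector_space_mpoly_scale)
  show ?thesis
    by unfold_locales
      (use assms linear_form_cancel in \<open>auto simp: mpoly_scale_def mult.assoc\<close>)
qed

locale linear_form_family =
  fixes L :: "('n::finite, 'k::field_char_0) mpoly set"
  assumes finite_L: "finite L" and linear_L: "\<And>a. a \<in> L \<Longrightarrow> a \<in> linear_forms \<and> a \<noteq> 0"

sublocale linear_form_family \<subseteq> form_family mpoly_scale L
  by (rule form_family_linear_forms[OF finite_L linear_L])

context linear_form_family
begin

lemma functional_lin_coeff: "functional (\<lambda>p. lin_coeff p i)"
  by unfold_locales (simp_all add: lookup_add algebra_simps)

lemma partial_deriv_eq_polar: "partial_deriv i (\<Prod>L) = polar UNIV (\<lambda>p. lin_coeff p i)"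
  unfolding partial_deriv_prod[OF finite_L] polar_def cofactor_def
  by (intro sum.cong) (auto simp: partial_deriv_linear_form linear_L mpoly_scale_def)

lemma gradient_ideal_eq_polar_ideal: "gradient_ideal (\<Prod>L) = polar_ideal"
proof
  show "gradient_ideal (\<Prod>L) \<subseteq> polar_ideal"
    unfolding gradient_ideal_def
    by (intro ideal_gen_minimal is_ideal_polar_ideal)
      (auto simp: partial_deriv_eq_polar intro!: polar_in_ideal functional_lin_coeff simp del: One_nat_def)
  have "polar UNIV \<phi> \<in> gradient_ideal (\<Prod>L)" if \<phi>: "functional \<phi>" for \<phi>
  proof -
    have "\<phi> a = (\<Sum>i\<in>UNIV. \<phi> (var i) * lin_coeff a i)" if "a \<in> L" for a
    proof -
      have "\<phi> a = \<phi> (\<Sum>i\<in>UNIV. mpoly_scale (lin_coeff a i) (var i))"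
        using linear_L[OF that] by (intro arg_cong[where f = \<phi>] linear_form_sum_vars) blast
      then show ?thesis
        by (simp add: module_hom.sum[OF module_hom_linearI[OF \<phi>]]
            module_hom.scale[OF module_hom_linearI[OF \<phi>]] mult.commute)
    qed
    then have "polar UNIV \<phi> = (\<Sum>a\<in>L. \<Sum>i\<in>UNIV. mpoly_scale (\<phi> (var i)) (mpoly_scale (lin_coeff a i) (cofactor a)))"
      unfolding polar_def by (intro sum.cong) (auto simp: scale_sum_left)
    also have "\<dots> = (\<Sum>i\<in>UNIV. mpoly_scale (\<phi> (var i)) (partial_deriv i (\<Prod>L)))"
      unfolding partial_deriv_eq_polar polar_def by (subst sum.swap) (simp add: scale_sum_right)
    also have "\<dots> \<in> gradient_ideal (\<Prod>L)"
      unfolding gradient_ideal_def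
      by (intro ideal_gen_sum ideal_scale_closed is_ideal_ideal_gen ideal_gen_base rangeI)
    finally show ?thesis .
  qed
  then show "polar_ideal \<subseteq> gradient_ideal (\<Prod>L)"
    unfolding polar_ideal_def gradient_ideal_def by (intro ideal_gen_minimal is_ideal_ideal_gen) blast
qed

text \<open>Substitute $x_i + \sum_b \varphi_b(x_i) s^{w_b}$ for $x_i$.  Modulo $s^W$ this is the identity substitution,
  so all coefficients in degrees between $0$ and \<open>W\<close> vanish.\<close>

lemma deformation_exists:
  assumes B: "independent B" and W: "0 < W" "\<And>b. b \<in> B \<Longrightarrow> W \<le> w b"
  shows "\<exists>\<tau>. deformation B w W \<tau>"
proof -
  define \<gamma> :: "'k \<Rightarrow> ('n, 'k) mpoly poly" where "\<gamma> c = [:Poly_Mapping.single 0 c:]" for c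
  define z where "z i = [:var i:] + (\<Sum>b\<in>B. monom (mpoly_scale (coord B b (var i)) 1) (w b))" for i
  let ?\<tau> = "mpoly_subst \<gamma> z"
  interpret coefficient_hom \<gamma> z
  proof
    fix c d
    show "\<gamma> (c * d) = \<gamma> c * \<gamma> d" by (simp add: \<gamma>_def mult_single mult.commute[of c d])
  qed (simp_all add: \<gamma>_def single_add)
  have "monom 1 W dvd (\<Sum>b\<in>B. monom (g b) (w b))" for g :: "_ \<Rightarrow> ('n, 'k) mpoly"
  proof (rule dvd_sum)
    fix b assume "b \<in> B"
    then have "monom (g b) (w b) = monom 1 W * monom (g b) (w b - W)" using W(2) by (simp add: mult_monom)
    then show "monom 1 W dvd monom (g b) (w b)" by simp
  qed
  then have "monom 1 W dvd ?\<tau> p - mpoly_subst \<gamma> (\<lambda>i. [:var i:]) p" for p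
    by (intro mpoly_subst_cong_mod coefficient_hom_axioms) (simp add: z_def)
  then have near: "monom 1 W dvd ?\<tau> p - [:p:]" for p
    unfolding \<gamma>_def[abs_def] mpoly_subst_self .
  have coeff_near: "coeff (?\<tau> p) i = coeff [:p:] i" if "i < W" for p i
  proof -
    obtain q where "?\<tau> p - [:p:] = monom 1 W * q" using near by (auto elim: dvdE)
    then have "coeff (?\<tau> p - [:p:]) i = 0" using that by (simp add: coeff_monom_mult)
    then show ?thesis by simp
  qed
  have form: "?\<tau> a = [:a:] + (\<Sum>b\<in>B. monom (mpoly_scale (coord B b a) 1) (w b))" if a: "a \<in> L" for a
  proof -
    have sum_a: "a = (\<Sum>i\<in>UNIV. mpoly_scale (lin_coeff a i) (var i))"
      using linear_form_sum_vars linear_L[OF a] by blast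
    have \<gamma>_const: "\<gamma> c * [:p:] = [:mpoly_scale c p:]" for c p
      by (simp add: \<gamma>_def mpoly_scale_def)
    have \<gamma>_monom: "\<gamma> c * monom (mpoly_scale d 1) k = monom (mpoly_scale (c * d) 1) k" for c d k
      by (simp add: \<gamma>_def mpoly_scale_def smult_monom mult_single)
    have "?\<tau> a = (\<Sum>i\<in>UNIV. \<gamma> (lin_coeff a i) * z i)"
      by (subst sum_a) (simp add: subst_sum subst_scale subst_var del: One_nat_def)
    also have "\<dots> = (\<Sum>i\<in>UNIV. [:mpoly_scale (lin_coeff a i) (var i):])
        + (\<Sum>i\<in>UNIV. \<Sum>b\<in>B. monom (mpoly_scale (lin_coeff a i * coord B b (var i)) 1) (w b))"
      unfolding z_def distrib_left sum.distrib sum_distrib_left \<gamma>_const \<gamma>_monom by (rule refl)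
    also have "(\<Sum>i\<in>UNIV. [:mpoly_scale (lin_coeff a i) (var i):]) = [:a:]"
      by (subst (2) sum_a) (simp add: sum_to_poly)
    also have "(\<Sum>i\<in>UNIV. \<Sum>b\<in>B. monom (mpoly_scale (lin_coeff a i * coord B b (var i)) (1 :: ('n, 'k) mpoly)) (w b))
        = (\<Sum>b\<in>B. monom (mpoly_scale (coord B b a) 1) (w b))"
    proof (subst sum.swap, intro sum.cong refl)
      fix b
      note lin = module_hom_linearI[OF functional_coord[OF B, of b]]
      have "coord B b a = (\<Sum>i\<in>UNIV. lin_coeff a i * coord B b (var i))"
        by (subst sum_a) (simp add: module_hom.sum[OF lin] module_hom.scale[OF lin])
      then show "(\<Sum>i\<in>UNIV. monom (mpoly_scale (lin_coeff a i * coord B b (var i)) (1 :: ('n, 'k) mpoly)) (w b))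
          = monom (mpoly_scale (coord B b a) 1) (w b)"
        by (intro poly_eqI) (simp add: coeff_sum scale_sum_left)
    qed
    finally show ?thesis .
  qed
  have "deformation B w W ?\<tau>"
    unfolding deformation_def
    using form coeff_near W(1) by (auto simp: subst_1 subst_add subst_mult coeff_pCons split: nat.split)
  then show ?thesis by blast
qed

end

theorem theorem2p1:
  fixes l :: "nat \<Rightarrow> ('n::finite, 'k::field_char_0) mpoly" and m :: nat
  assumes "central_arrangement m l"
    and "arrangement_rank m l = CARD('n)"
  shows "is_minimal_reduction (gradient_ideal (defining_poly m l)) (fold_product_ideal m l) \<and>
    reduction_number (gradient_ideal (defining_poly m l)) (fold_product_ideal m l) \<le> CARD('n) - 1"
proof -
  let ?L = "l ` {1..m}"
  interpret linear_form_family ?L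
    using assms(1) by unfold_locales (auto simp: central_arrangement_def)
  \<comment> \<open>Distinct hyperplanes make the forms distinct, so products over indices are products over the set of forms.\<close>
  have inj: "inj_on l {1..m}"
    using assms(1) unfolding central_arrangement_def inj_on_def by metis
  have f: "defining_poly m l = \<Prod>?L"
    unfolding defining_poly_def by (simp add: prod.reindex[OF inj] del: One_nat_def)
  have J: "gradient_ideal (defining_poly m l) = polar_ideal"
    by (simp only: f gradient_ideal_eq_polar_ideal)
  have "(\<Prod>j\<in>{1..m} - {i}. l j) = cofactor (l i)" if "i \<in> {1..m}" for i
  proof -
    have "?L - {l i} = l ` ({1..m} - {i})"
      using inj_on_image_set_diff[OF inj Diff_subset, of "{i}"] that by simp
    moreover have "inj_on l ({1..m} - {i})" using inj by (rule inj_on_diff)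
    ultimately show ?thesis unfolding cofactor_def by (simp only: prod.reindex o_def)
  qed
  then have "(\<lambda>i. \<Prod>j\<in>{1..m} - {i}. l j) ` {1..m} = (\<lambda>i. cofactor (l i)) ` {1..m}"
    by (rule image_cong[OF refl])
  then have I: "fold_product_ideal m l = cofactor_ideal"
    by (simp only: fold_product_ideal_def cofactor_ideal_def image_image)
  have dim: "dim ?L = CARD('n)" using assms(2) by (simp add: arrangement_rank_def)
  have n: "CARD('n) > 0" by simp
  have ne: "?L \<noteq> {}" 
  proof
    assume "?L = {}"
    then show False using dim n dim_le_card[of ?L "{}"] by simp
  qed
  let ?n = "CARD('n) - 1"
  have eq: "ideal_power cofactor_ideal (?n + 1) = ideal_mult polar_ideal (ideal_power cofactor_ideal ?n)"
  proof
    show "ideal_power cofactor_ideal (?n + 1) \<subseteq> ideal_mult polar_ideal (ideal_power cofactor_ideal ?n)"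
      using cofactor_power_reduces[of "CARD('n)"] dim n by simp
    show "ideal_mult polar_ideal (ideal_power cofactor_ideal ?n) \<subseteq> ideal_power cofactor_ideal (?n + 1)"
      unfolding Suc_eq_plus1[symmetric] ideal_power.simps
      by (rule ideal_mult_mono[OF polar_ideal_subset order_refl])
  qed
  have red: "is_reduction polar_ideal cofactor_ideal"
    unfolding is_reduction_def
  proof (intro conjI exI)
    show "is_ideal cofactor_ideal" unfolding cofactor_ideal_def by (rule is_ideal_ideal_gen)
  qed (fact is_ideal_polar_ideal polar_ideal_subset eq)+
  have "K = polar_ideal" if K: "is_reduction K cofactor_ideal" "K \<subseteq> polar_ideal" for K
  proof -
    obtain r where "ideal_power cofactor_ideal (r + 1) = ideal_mult K (ideal_power cofactor_ideal r)"
      using K(1) unfolding is_reduction_def by blast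
    then have "ideal_power cofactor_ideal (Suc r) \<subseteq> ideal_mult K (ideal_power cofactor_ideal r)"
      by (simp only: Suc_eq_plus1)
    moreover have "is_ideal K" using K(1) unfolding is_reduction_def by blast
    ultimately show ?thesis
      using K(2) by (intro polar_ideal_minimal[OF ne]) (rule deformation_exists)
  qed
  then have "is_minimal_reduction polar_ideal cofactor_ideal"
    using red unfolding is_minimal_reduction_def by blast
  moreover have "reduction_number polar_ideal cofactor_ideal \<le> ?n"
    unfolding reduction_number_def by (rule Least_le) (rule eq)
  ultimately show ?thesis unfolding I J by (rule conjI)
qed

end
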